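(* Let $(X,d)$ be a metric space that is a Polish space, let $m\ge 1$ and let $x_0\in X$ be the base point used to define $\mathcal{L}(X,\mathbb{R}^m)$. Define $$T\colon\mathcal{L}(X,\mathbb{R}^m)\to\mathcal{W}(X,\mathbb{R}^m)^*,\qquad T(u)(\mu)=\int_{X}\langle u,d\mu\rangle,$$ and $$S\colon\mathcal{W}(X,\mathbb{R}^m)^*\to \mathcal{L}(X,\mathbb{R}^m),\qquad \langle S(\lambda)(x),w\rangle=\lambda\big((\delta_x-\delta_{x_0})w\big)\quad\text{for all } x\in X,\ w\in\mathbb{R}^m.$$ Then $S$ and $T$ are mutually inverse and establish an isometric isomorphism of $\mathcal{L}(X,\mathbb{R}^m)$ and $\mathcal{W}(X,\mathbb{R}^m)^*$.
   Context: $\mathbb{R}^m$ carries the Euclidean norm $\|\cdot\|$ and the standard scalar product $\langle\cdot,\cdot\rangle$. For an $\mathbb{R}^m$-valued Borel measure $\mu$, $\|\mu\|$ denotes its total variation measure, and $\int\langle u,d\mu\rangle=\sum_{i=1}^m\int u_i\,d\mu_i$. For an $\mathbb{R}^m$-valued Borel measure $\pi$ on $X\times X$, its marginals are $\mathrm{P}_1\pi(A)=\pi(A\times X)$ and $\mathrm{P}_2\pi(A)=\pi(X\times A)$ for Borel $A\subset X$. $\Gamma(\mu)$ is the set of all $\mathbb{R}^m$-valued Borel measures $\pi$ on $X\times X$ with $\mathrm{P}_1\pi-\mathrm{P}_2\pi=\mu$. The Wasserstein space $\mathcal{W}(X,\mathbb{R}^m)$ is the space of all $\mathbb{R}^m$-valued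 Borel measures $\mu$ on $X$ with $\mu(X)=0$ and $\int_X d(x,x_0)\,d\|\mu\|(x)<\infty$ for some $x_0\in X$, with the norm $$\|\mu\|_{\mathcal{W}(X,\mathbb{R}^m)}=\inf\Big\{\int_{X\times X}d(x,y)\,d\|\pi\|(x,y)\mid \pi\in\Gamma(\mu)\Big\}.$$ $\mathcal{W}(X,\mathbb{R}^m)^*$ is its dual space of continuous linear functionals with the operator norm. $\delta_x$ is the Dirac probability measure at $x$. For a fixed $x_0\in X$, $\mathcal{L}(X,\mathbb{R}^m)$ is the Banach space of Lipschitz maps $u\colon X\to\mathbb{R}^m$ with $u(x_0)=0$, with norm $\|u\|_{\mathcal{L}(X,\mathbb{R}^m)}=\sup\big\{\|u(x)-u(y)\|/d(x,y)\mid x,y\in X,\ x\ne y\big\}$. *)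

theory Defs
  imports "HOL-Analysis.Analysis"
begin

text \<open>
  A vector measure is a countably additive set function on the Borel sets. Outside the Borel
  sets it is set to 0, so that equality of vector measures is equality on Borel sets.
\<close>

definition vector_measure :: "('a::topological_space set \<Rightarrow> 'b::real_normed_vector) \<Rightarrow> bool" where
  "vector_measure \<mu> \<longleftrightarrow> (\<forall>A. A \<notin> sets borel \<longrightarrow> \<mu> A = 0) \<and>
     (\<forall>E :: nat \<Rightarrow> 'a set. range E \<subseteq> sets borel \<longrightarrow> disjoint_family E \<longrightarrow>
        (\<lambda>n. \<mu> (E n)) sums \<mu> (\<Union>n. E n))"

typedef (overloaded) ('a::topological_space, 'b::real_normed_vector) vmeasure =
  "{\<mu> :: 'a set \<Rightarrow> 'b. vector_measure \<mu>}"
  morphisms vm Abs_vmeasure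
proof
  show "(\<lambda>_. 0) \<in> {\<mu> :: 'a set \<Rightarrow> 'b. vector_measure \<mu>}"
    by (simp add: vector_measure_def)
qed

setup_lifting type_definition_vmeasure

lemma vm_sums:
  assumes "range E \<subseteq> sets borel" "disjoint_family E"
  shows "(\<lambda>n. vm \<mu> (E n)) sums vm \<mu> (\<Union>n. E n)"
  using vm[of \<mu>] assms by (auto simp: vector_measure_def)

lemma vm_empty [simp]: "vm \<mu> {} = 0"
proof -
  have "(\<lambda>n::nat. vm \<mu> {}) sums vm \<mu> (\<Union>n::nat. {})"
    by (rule vm_sums) (auto simp: disjoint_family_on_def)
  then have "summable (\<lambda>n::nat. vm \<mu> {})"
    by (rule sums_summable)
  then show ?thesis
    using summable_const_iff by blast
qed

lemma vm_Un:
  assumes "A \<in> sets borel" "B \<in> sets borel" "A \<inter> B = {}"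
  shows "vm \<mu> (A \<union> B) = vm \<mu> A + vm \<mu> B"
proof -
  have "(\<lambda>n. vm \<mu> (binaryset A B n)) sums vm \<mu> (\<Union>n. binaryset A B n)"
    using assms
    by (intro vm_sums) (auto simp: disjoint_family_on_def binaryset_def)
  moreover have "(\<lambda>n. vm \<mu> (binaryset A B n)) sums (vm \<mu> A + vm \<mu> B)"
    by (rule binaryset_sums) simp
  ultimately show ?thesis
    using sums_unique2 by (metis UN_binaryset_eq)
qed

instantiation vmeasure :: (topological_space, real_normed_vector) real_vector
begin

lift_definition zero_vmeasure :: "('a, 'b) vmeasure" is "\<lambda>_. 0"
  by (simp add: vector_measure_def)

lift_definition plus_vmeasure :: "('a, 'b) vmeasure \<Rightarrow> ('a, 'b) vmeasure \<Rightarrow> ('a, 'b) vmeasure"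
  is "\<lambda>\<mu> \<nu> A. \<mu> A + \<nu> A"
  by (auto simp: vector_measure_def intro!: sums_add)

lift_definition uminus_vmeasure :: "('a, 'b) vmeasure \<Rightarrow> ('a, 'b) vmeasure"
  is "\<lambda>\<mu> A. - \<mu> A"
  by (auto simp: vector_measure_def intro!: sums_minus)

lift_definition minus_vmeasure :: "('a, 'b) vmeasure \<Rightarrow> ('a, 'b) vmeasure \<Rightarrow> ('a, 'b) vmeasure"
  is "\<lambda>\<mu> \<nu> A. \<mu> A - \<nu> A"
  by (auto simp: vector_measure_def intro!: sums_diff)

lift_definition scaleR_vmeasure :: "real \<Rightarrow> ('a, 'b) vmeasure \<Rightarrow> ('a, 'b) vmeasure"
  is "\<lambda>c \<mu> A. c *\<^sub>R \<mu> A"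
  by (auto simp: vector_measure_def intro!: sums_scaleR_right)

instance
  by standard (transfer; simp add: algebra_simps)+

end

lift_definition dirac_vm :: "'a::topological_space \<Rightarrow> 'b::real_normed_vector \<Rightarrow> ('a, 'b) vmeasure"
  is "\<lambda>x w A. if A \<in> sets borel then indicat_real A x *\<^sub>R w else 0"
proof (unfold vector_measure_def, intro conjI allI impI)
  fix x :: 'a and w :: 'b and E :: "nat \<Rightarrow> 'a set"
  assume E: "range E \<subseteq> sets borel" "disjoint_family E"
  have "(\<lambda>n. indicat_real (E n) x) sums indicat_real (\<Union>n. E n) x"
  proof (cases "\<exists>n. x \<in> E n")
    case True
    then obtain n where n: "x \<in> E n" by blast
    have "indicat_real (E k) x = (if k = n then 1 else 0)" for k
      using n E(2) by (auto simp: disjoint_family_on_def indicator_def)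
    then show ?thesis
      using n sums_single[of n "\<lambda>_. 1::real"] by (auto simp: indicator_def)
  next
    case False
    then show ?thesis by (auto simp: indicator_def)
  qed
  then have "(\<lambda>n. indicat_real (E n) x *\<^sub>R w) sums (indicat_real (\<Union>n. E n) x *\<^sub>R w)"
    by (rule sums_scaleR_left)
  then show "(\<lambda>n. if E n \<in> sets borel then indicat_real (E n) x *\<^sub>R w else 0) sums
      (if \<Union> (range E) \<in> sets borel then indicat_real (\<Union> (range E)) x *\<^sub>R w else 0)"
    using E(1) by (auto simp: range_subsetD)
qed auto

lemma times_UNIV_borel:
  fixes A :: "'a::topological_space set"
  assumes "A \<in> sets borel"
  shows "(A \<times> UNIV :: ('a \<times> 'b::topological_space) set) \<in> sets borel"
    and "(UNIV \<times> A :: ('b \<times> 'a) set) \<in> sets borel"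
proof -
  have "fst \<in> borel_measurable (borel :: ('a \<times> 'b) measure)"
    by (intro borel_measurable_continuous_onI continuous_intros)
  from measurable_sets[OF this assms] show "(A \<times> UNIV :: ('a \<times> 'b) set) \<in> sets borel"
    by (simp add: fst_vimage_eq_Times)
  have "snd \<in> borel_measurable (borel :: ('b \<times> 'a) measure)"
    by (intro borel_measurable_continuous_onI continuous_intros)
  from measurable_sets[OF this assms] show "(UNIV \<times> A :: ('b \<times> 'a) set) \<in> sets borel"
    by (simp add: snd_vimage_eq_Times)
qed

lift_definition marginal1 ::
  "('a::topological_space \<times> 'a, 'b::real_normed_vector) vmeasure \<Rightarrow> ('a, 'b) vmeasure"
  is "\<lambda>\<pi> A. if A \<in> sets borel then \<pi> (A \<times> UNIV) else 0"
proof (subst vector_measure_def, intro conjI allI impI)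
  fix \<pi> :: "('a \<times> 'a) set \<Rightarrow> 'b" and E :: "nat \<Rightarrow> 'a set"
  assume pi: "vector_measure \<pi>"
    and E: "range E \<subseteq> sets borel" "disjoint_family E"
  have "range (\<lambda>n. E n \<times> (UNIV :: 'a set)) \<subseteq> sets borel"
    using E(1) by (auto intro!: times_UNIV_borel)
  moreover have "disjoint_family (\<lambda>n. E n \<times> (UNIV :: 'a set))"
    using E(2) by (auto simp: disjoint_family_on_def)
  ultimately have "(\<lambda>n. \<pi> (E n \<times> UNIV)) sums \<pi> (\<Union>n. E n \<times> UNIV)"
    using pi by (simp add: vector_measure_def)
  moreover have "(\<Union>n. E n \<times> (UNIV :: 'a set)) = (\<Union>n. E n) \<times> UNIV" by auto
  moreover have "E n \<in> sets borel" for n using E(1) by auto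
  moreover have "(\<Union>n. E n) \<in> sets borel" using E(1) by auto
  ultimately show "(\<lambda>n. if E n \<in> sets borel then \<pi> (E n \<times> UNIV) else 0) sums
      (if \<Union> (range E) \<in> sets borel then \<pi> (\<Union> (range E) \<times> UNIV) else 0)"
    by simp
qed auto

lift_definition marginal2 ::
  "('a::topological_space \<times> 'a, 'b::real_normed_vector) vmeasure \<Rightarrow> ('a, 'b) vmeasure"
  is "\<lambda>\<pi> A. if A \<in> sets borel then \<pi> (UNIV \<times> A) else 0"
proof (subst vector_measure_def, intro conjI allI impI)
  fix \<pi> :: "('a \<times> 'a) set \<Rightarrow> 'b" and E :: "nat \<Rightarrow> 'a set"
  assume pi: "vector_measure \<pi>"
    and E: "range E \<subseteq> sets borel" "disjoint_family E"
  have "range (\<lambda>n. (UNIV :: 'a set) \<times> E n) \<subseteq> sets borel"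
    using E(1) by (auto intro!: times_UNIV_borel)
  moreover have "disjoint_family (\<lambda>n. (UNIV :: 'a set) \<times> E n)"
    using E(2) by (auto simp: disjoint_family_on_def)
  ultimately have "(\<lambda>n. \<pi> (UNIV \<times> E n)) sums \<pi> (\<Union>n. UNIV \<times> E n)"
    using pi by (simp add: vector_measure_def)
  moreover have "(\<Union>n. (UNIV :: 'a set) \<times> E n) = UNIV \<times> (\<Union>n. E n)" by auto
  moreover have "E n \<in> sets borel" for n using E(1) by auto
  moreover have "(\<Union>n. E n) \<in> sets borel" using E(1) by auto
  ultimately show "(\<lambda>n. if E n \<in> sets borel then \<pi> (UNIV \<times> E n) else 0) sums
      (if \<Union> (range E) \<in> sets borel then \<pi> (UNIV \<times> \<Union> (range E)) else 0)"
    by simp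
qed auto

lift_definition component_vm :: "'m \<Rightarrow> ('a::topological_space, real^'m) vmeasure \<Rightarrow> ('a, real) vmeasure"
  is "\<lambda>i \<mu> A. \<mu> A $ i"
proof -
  fix i :: 'm and \<mu> :: "'a set \<Rightarrow> real^'m"
  assume "vector_measure \<mu>"
  then show "vector_measure (\<lambda>A. \<mu> A $ i)"
    by (auto simp: vector_measure_def intro!: bounded_linear.sums[OF bounded_linear_vec_nth])
qed

definition borel_partitions :: "'a::topological_space set \<Rightarrow> 'a set set set" where
  "borel_partitions A = {P. finite P \<and> P \<subseteq> sets borel \<and> disjoint P \<and> \<Union>P = A}"

text \<open>
  Finite Borel partitions give the same supremum as countable ones, by countable additivity of
  \<open>\<mu>\<close> (truncate a countable partition and lump the remainder into one set).
\<close>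

definition variation :: "('a::topological_space, 'b::real_normed_vector) vmeasure \<Rightarrow> 'a set \<Rightarrow> ennreal" where
  "variation \<mu> A = (SUP P \<in> borel_partitions A. \<Sum>E\<in>P. ennreal (norm (vm \<mu> E)))"

definition total_variation :: "('a::topological_space, 'b::real_normed_vector) vmeasure \<Rightarrow> 'a measure" where
  "total_variation \<mu> = measure_of UNIV (sets borel) (variation \<mu>)"

definition upper_variation :: "('a::topological_space, real) vmeasure \<Rightarrow> 'a set \<Rightarrow> ennreal" where
  "upper_variation \<nu> A = (SUP B \<in> {B \<in> sets borel. B \<subseteq> A}. ennreal (vm \<nu> B))"

text \<open>
  The positive part of the Jordan decomposition of a signed measure \<open>\<nu>\<close>; the negative part
  is the positive part of \<open>- \<nu>\<close>.
\<close>

definition positive_part :: "('a::topological_space, real) vmeasure \<Rightarrow> 'a measure" where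
  "positive_part \<nu> = measure_of UNIV (sets borel) (upper_variation \<nu>)"

definition signed_integrable :: "('a::topological_space, real) vmeasure \<Rightarrow> ('a \<Rightarrow> real) \<Rightarrow> bool" where
  "signed_integrable \<nu> f \<longleftrightarrow> integrable (positive_part \<nu>) f \<and> integrable (positive_part (- \<nu>)) f"

definition signed_integral :: "('a::topological_space, real) vmeasure \<Rightarrow> ('a \<Rightarrow> real) \<Rightarrow> real" where
  "signed_integral \<nu> f = (\<integral>x. f x \<partial>positive_part \<nu>) - (\<integral>x. f x \<partial>positive_part (- \<nu>))"

definition vm_integrable :: "('a::topological_space, real^'m) vmeasure \<Rightarrow> ('a \<Rightarrow> real^'m) \<Rightarrow> bool" where
  "vm_integrable \<mu> u \<longleftrightarrow> (\<forall>i. signed_integrable (component_vm i \<mu>) (\<lambda>x. u x $ i))"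

definition vm_integral :: "('a::topological_space, real^'m) vmeasure \<Rightarrow> ('a \<Rightarrow> real^'m) \<Rightarrow> real" where
  "vm_integral \<mu> u = (\<Sum>i\<in>UNIV. signed_integral (component_vm i \<mu>) (\<lambda>x. u x $ i))"

text \<open>
  The set functions above are countably additive for every vector measure, so the two uses of
  \<open>measure_of\<close> do not fall back to the zero measure.
\<close>

lemma countably_additive_superadd:
  fixes f :: "'a::topological_space set \<Rightarrow> ennreal"
  assumes mono: "\<And>A B. A \<in> sets borel \<Longrightarrow> B \<in> sets borel \<Longrightarrow> A \<subseteq> B \<Longrightarrow> f A \<le> f B"
    and super: "\<And>A B. A \<in> sets borel \<Longrightarrow> B \<in> sets borel \<Longrightarrow> A \<inter> B = {} \<Longrightarrow> f A + f B \<le> f (A \<union> B)"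
    and sub: "\<And>E :: nat \<Rightarrow> 'a set. range E \<subseteq> sets borel \<Longrightarrow> disjoint_family E \<Longrightarrow> f (\<Union>n. E n) \<le> (\<Sum>n. f (E n))"
    and empty: "f {} = 0"
  shows "measure_space UNIV (sets borel) f"
proof -
  have "(\<Sum>n. f (E n)) = f (\<Union>n. E n)"
    if E: "range E \<subseteq> sets borel" "disjoint_family E" for E :: "nat \<Rightarrow> 'a set"
  proof (rule antisym)
    have "(\<Sum>i<n. f (E i)) \<le> f (\<Union>i<n. E i)" for n
    proof (induction n)
      case 0
      then show ?case by (simp add: empty)
    next
      case (Suc n)
      have "E i \<inter> E n = {}" if "i < n" for i
        using disjoint_family_onD[OF E(2), of i n] that by simp
      then have "(\<Union>i<n. E i) \<inter> E n = {}"
        by blast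
      moreover have "(\<Union>i<n. E i) \<in> sets borel" "E n \<in> sets borel"
        using E(1) by auto
      ultimately have "f (\<Union>i<n. E i) + f (E n) \<le> f ((\<Union>i<n. E i) \<union> E n)"
        by (intro super)
      also have "(\<Union>i<n. E i) \<union> E n = (\<Union>i<Suc n. E i)"
        by (auto simp: lessThan_Suc)
      finally show ?case
        using Suc.IH by (simp add: order_trans[OF add_right_mono])
    qed
    also have "f (\<Union>i<n. E i) \<le> f (\<Union>i. E i)" for n
      using E(1) by (intro mono) auto
    finally show "(\<Sum>n. f (E n)) \<le> f (\<Union>n. E n)"
      by (intro suminf_le_const) auto
  qed (rule sub[OF E])
  moreover have "sigma_algebra UNIV (sets (borel :: 'a measure))"
    using sets.sigma_algebra_axioms[of "borel :: 'a measure"] by simp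
  ultimately show ?thesis
    by (auto simp: measure_space_def positive_def countably_additive_def empty)
qed

lemma measure_space_variation: "measure_space UNIV (sets borel) (variation \<mu>)"
proof (rule countably_additive_superadd)
  have ne: "borel_partitions A \<noteq> {}" if "A \<in> sets borel" for A :: "'a set"
  proof -
    have "{A} \<in> borel_partitions A" using that by (auto simp: borel_partitions_def)
    then show ?thesis by blast
  qed
  show super: "variation \<mu> A + variation \<mu> B \<le> variation \<mu> (A \<union> B)"
    if AB: "A \<in> sets borel" "B \<in> sets borel" "A \<inter> B = {}" for A B
  proof -
    let ?s = "\<lambda>P. \<Sum>E\<in>P. ennreal (norm (vm \<mu> E))"
    have "?s P + ?s Q \<le> variation \<mu> (A \<union> B)"
      if P: "P \<in> borel_partitions A" and Q: "Q \<in> borel_partitions B" for P Q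
    proof -
      have "P \<inter> Q \<subseteq> {{}}"
        using P Q AB(3) unfolding borel_partitions_def by blast
      then have "?s (P \<inter> Q) = 0"
        by (intro sum.neutral) auto
      then have "?s P + ?s Q = ?s (P \<union> Q)"
        using sum.union_inter[of P Q "\<lambda>E. ennreal (norm (vm \<mu> E))"] P Q
        by (simp add: borel_partitions_def)
      moreover have "P \<union> Q \<in> borel_partitions (A \<union> B)"
        using P Q AB(3) unfolding borel_partitions_def
        by (auto intro!: disjoint_union)
      ultimately show ?thesis
        unfolding variation_def by (metis SUP_upper)
    qed
    then have "?s P + variation \<mu> B \<le> variation \<mu> (A \<union> B)" if "P \<in> borel_partitions A" for P
      using that ne[OF AB(2)] unfolding variation_def[of \<mu> B]
      by (subst ennreal_SUP_add_right) (auto intro: SUP_least)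
    then show ?thesis
      using ne[OF AB(1)] unfolding variation_def[of \<mu> A]
      by (subst ennreal_SUP_add_left[symmetric]) (auto intro!: SUP_least)
  qed
  show "variation \<mu> A \<le> variation \<mu> B" if "A \<in> sets borel" "B \<in> sets borel" "A \<subseteq> B" for A B
  proof -
    have "variation \<mu> A \<le> variation \<mu> A + variation \<mu> (B - A)" by simp
    also have "\<dots> \<le> variation \<mu> (A \<union> (B - A))"
      using that by (intro super) auto
    finally show ?thesis using that(3) by (simp add: Un_absorb1)
  qed
  show "variation \<mu> {} = 0"
  proof -
    have "(\<Sum>E\<in>P. ennreal (norm (vm \<mu> E))) = 0" if "P \<in> borel_partitions {}" for P
    proof (rule sum.neutral, rule ballI)
      fix E assume "E \<in> P"
      then have "E = {}" using that by (auto simp: borel_partitions_def)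
      then show "ennreal (norm (vm \<mu> E)) = 0" by simp
    qed
    then show ?thesis
      using ne[of "{}"] by (simp add: variation_def)
  qed
  show "variation \<mu> (\<Union>n. E n) \<le> (\<Sum>n. variation \<mu> (E n))"
    if E: "range E \<subseteq> sets borel" "disjoint_family E" for E :: "nat \<Rightarrow> 'a set"
    unfolding variation_def[of \<mu> "\<Union>n. E n"]
  proof (rule SUP_least)
    fix P assume P: "P \<in> borel_partitions (\<Union>n. E n)"
    have "ennreal (norm (vm \<mu> F)) \<le> (\<Sum>n. ennreal (norm (vm \<mu> (F \<inter> E n))))" if F: "F \<in> P" for F
    proof -
      have "(\<lambda>n. vm \<mu> (F \<inter> E n)) sums vm \<mu> (\<Union>n. F \<inter> E n)"
      proof (rule vm_sums)
        have "F \<in> sets borel" using P F by (auto simp: borel_partitions_def)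
        then show "range (\<lambda>n. F \<inter> E n) \<subseteq> sets borel" using E(1) by auto
        show "disjoint_family (\<lambda>n. F \<inter> E n)"
          using E(2) unfolding disjoint_family_on_def by blast
      qed
      moreover have "(\<Union>n. F \<inter> E n) = F"
        using P F by (auto simp: borel_partitions_def)
      ultimately have lim: "(\<lambda>n. norm (\<Sum>i<n. vm \<mu> (F \<inter> E i))) \<longlonglongrightarrow> norm (vm \<mu> F)"
        by (intro tendsto_norm) (simp add: sums_def)
      have "ennreal (norm (\<Sum>i<n. vm \<mu> (F \<inter> E i))) \<le> (\<Sum>n. ennreal (norm (vm \<mu> (F \<inter> E n))))" for n
      proof -
        have "ennreal (norm (\<Sum>i<n. vm \<mu> (F \<inter> E i))) \<le> ennreal (\<Sum>i<n. norm (vm \<mu> (F \<inter> E i)))"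
          by (intro ennreal_leI norm_sum)
        also have "\<dots> = (\<Sum>i<n. ennreal (norm (vm \<mu> (F \<inter> E i))))"
          by (rule sum_ennreal[symmetric]) simp
        also have "\<dots> \<le> (\<Sum>n. ennreal (norm (vm \<mu> (F \<inter> E n))))"
          by (intro sum_le_suminf) auto
        finally show ?thesis .
      qed
      then show ?thesis
        by (intro LIMSEQ_le_const2[OF tendsto_ennrealI[OF lim]]) auto
    qed
    then have "(\<Sum>F\<in>P. ennreal (norm (vm \<mu> F))) \<le> (\<Sum>F\<in>P. \<Sum>n. ennreal (norm (vm \<mu> (F \<inter> E n))))"
      by (rule sum_mono)
    also have "\<dots> = (\<Sum>n. \<Sum>F\<in>P. ennreal (norm (vm \<mu> (F \<inter> E n))))"
      by (rule suminf_sum[symmetric]) simp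
    also have "\<dots> \<le> (\<Sum>n. variation \<mu> (E n))"
    proof (intro suminf_le allI)
      fix n
      let ?Q = "(\<lambda>F. F \<inter> E n) ` P"
      have "\<Union>?Q = E n"
        using P by (auto simp: borel_partitions_def)
      moreover have "disjoint ?Q"
        using P unfolding borel_partitions_def disjoint_def by blast
      moreover have "?Q \<subseteq> sets borel" "finite ?Q"
        using P E(1) by (auto simp: borel_partitions_def)
      ultimately have "?Q \<in> borel_partitions (E n)"
        by (simp add: borel_partitions_def)
      moreover have "(\<Sum>F\<in>P. ennreal (norm (vm \<mu> (F \<inter> E n)))) = (\<Sum>F\<in>?Q. ennreal (norm (vm \<mu> F)))"
      proof (subst sum.reindex_nontrivial)
        show "finite P" using P by (simp add: borel_partitions_def)
        show "ennreal (norm (vm \<mu> (F \<inter> E n))) = 0"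
          if "F \<in> P" "G \<in> P" "F \<noteq> G" "F \<inter> E n = G \<inter> E n" for F G
        proof -
          have "F \<inter> G = {}" using P that by (auto simp: borel_partitions_def disjoint_def)
          then have "F \<inter> E n = {}" using that(4) by blast
          then show ?thesis by simp
        qed
      qed (simp add: o_def)
      ultimately show "(\<Sum>F\<in>P. ennreal (norm (vm \<mu> (F \<inter> E n)))) \<le> variation \<mu> (E n)"
        unfolding variation_def by (metis SUP_upper)
    qed auto
    finally show "(\<Sum>F\<in>P. ennreal (norm (vm \<mu> F))) \<le> (\<Sum>n. variation \<mu> (E n))" .
  qed
qed

lemma measure_space_upper_variation: "measure_space UNIV (sets borel) (upper_variation \<nu>)"
proof (rule countably_additive_superadd)
  show "upper_variation \<nu> A \<le> upper_variation \<nu> B" if "A \<subseteq> B" for A B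
    unfolding upper_variation_def using that by (intro SUP_subset_mono) auto
  show "upper_variation \<nu> {} = 0"
    unfolding upper_variation_def by (auto intro!: antisym SUP_least)
  show "upper_variation \<nu> A + upper_variation \<nu> B \<le> upper_variation \<nu> (A \<union> B)"
    if AB: "A \<in> sets borel" "B \<in> sets borel" "A \<inter> B = {}" for A B
  proof -
    have *: "ennreal (vm \<nu> C) + ennreal (vm \<nu> D) \<le> upper_variation \<nu> (A \<union> B)"
      if C: "C \<in> sets borel" "C \<subseteq> A" and D: "D \<in> sets borel" "D \<subseteq> B" for C D
    proof -
      let ?C = "if vm \<nu> C \<ge> 0 then C else {}" and ?D = "if vm \<nu> D \<ge> 0 then D else {}"
      have "ennreal (vm \<nu> C) + ennreal (vm \<nu> D) = ennreal (vm \<nu> ?C) + ennreal (vm \<nu> ?D)"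
        by (simp add: ennreal_neg)
      also have "\<dots> = ennreal (vm \<nu> ?C + vm \<nu> ?D)"
        by (subst ennreal_plus) auto
      also have "vm \<nu> ?C + vm \<nu> ?D = vm \<nu> (?C \<union> ?D)"
        using C D AB(3) by (intro vm_Un[symmetric]) auto
      also have "ennreal (vm \<nu> (?C \<union> ?D)) \<le> upper_variation \<nu> (A \<union> B)"
        unfolding upper_variation_def using C D by (intro SUP_upper) auto
      finally show ?thesis .
    qed
    have ne: "{C \<in> sets borel. C \<subseteq> A} \<noteq> {}" for A :: "'a set" by blast
    have "ennreal (vm \<nu> C) + upper_variation \<nu> B \<le> upper_variation \<nu> (A \<union> B)"
      if "C \<in> sets borel" "C \<subseteq> A" for C
      using * that ne unfolding upper_variation_def[of \<nu> B]
      by (subst ennreal_SUP_add_right) (auto intro: SUP_least)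
    then show ?thesis
      using ne unfolding upper_variation_def[of \<nu> A]
      by (subst ennreal_SUP_add_left[symmetric]) (auto intro!: SUP_least)
  qed
  show "upper_variation \<nu> (\<Union>n. E n) \<le> (\<Sum>n. upper_variation \<nu> (E n))"
    if E: "range E \<subseteq> sets borel" "disjoint_family E" for E :: "nat \<Rightarrow> 'a set"
    unfolding upper_variation_def[of \<nu> "\<Union>n. E n"]
  proof (rule SUP_least, clarify)
    fix B :: "'a set" assume B: "B \<in> sets borel" "B \<subseteq> (\<Union>n. E n)"
    have "(\<lambda>n. vm \<nu> (B \<inter> E n)) sums vm \<nu> (\<Union>n. B \<inter> E n)"
      using E B by (intro vm_sums) (auto simp: disjoint_family_on_def)
    moreover have "(\<Union>n. B \<inter> E n) = B" using B by auto
    ultimately have lim: "(\<lambda>n. \<Sum>i<n. vm \<nu> (B \<inter> E i)) \<longlonglongrightarrow> vm \<nu> B"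
      by (simp add: sums_def)
    have "ennreal (\<Sum>i<n. vm \<nu> (B \<inter> E i)) \<le> (\<Sum>n. upper_variation \<nu> (E n))" for n
    proof -
      have "ennreal (\<Sum>i<n. vm \<nu> (B \<inter> E i)) \<le> ennreal (\<Sum>i<n. max 0 (vm \<nu> (B \<inter> E i)))"
        by (intro ennreal_leI sum_mono) simp
      also have "\<dots> = (\<Sum>i<n. ennreal (max 0 (vm \<nu> (B \<inter> E i))))"
        by (rule sum_ennreal[symmetric]) simp
      also have "\<dots> \<le> (\<Sum>i<n. upper_variation \<nu> (E i))"
      proof (rule sum_mono)
        fix i
        have "ennreal (vm \<nu> (B \<inter> E i)) \<le> upper_variation \<nu> (E i)"
          unfolding upper_variation_def using B(1) E(1) by (intro SUP_upper) auto
        then show "ennreal (max 0 (vm \<nu> (B \<inter> E i))) \<le> upper_variation \<nu> (E i)"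
          by (simp add: max_def)
      qed
      also have "\<dots> \<le> (\<Sum>n. upper_variation \<nu> (E n))"
        by (intro sum_le_suminf) auto
      finally show ?thesis .
    qed
    then show "ennreal (vm \<nu> B) \<le> (\<Sum>n. upper_variation \<nu> (E n))"
      by (intro LIMSEQ_le_const2[OF tendsto_ennrealI[OF lim]]) auto
  qed
qed

lemma sets_total_variation [simp]: "sets (total_variation \<mu>) = sets borel"
  and space_total_variation [simp]: "space (total_variation \<mu>) = UNIV"
  and emeasure_total_variation: "A \<in> sets borel \<Longrightarrow> emeasure (total_variation \<mu>) A = variation \<mu> A"
proof -
  have sa: "sigma_algebra UNIV (sets (borel :: 'a measure))"
    using sets.sigma_algebra_axioms[of "borel :: 'a measure"] by simp
  show "sets (total_variation \<mu>) = sets borel"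
    unfolding total_variation_def
    by (subst sets_measure_of) (auto intro!: sigma_algebra.sigma_sets_eq[OF sa])
  show "space (total_variation \<mu>) = UNIV"
    unfolding total_variation_def by (subst space_measure_of) auto
  show "A \<in> sets borel \<Longrightarrow> emeasure (total_variation \<mu>) A = variation \<mu> A"
    using measure_space_variation[of \<mu>] unfolding total_variation_def
    by (intro emeasure_measure_of_sigma[OF sa]) (auto simp: measure_space_def)
qed

lemma sets_positive_part [simp]: "sets (positive_part \<nu>) = sets borel"
  and space_positive_part [simp]: "space (positive_part \<nu>) = UNIV"
  and emeasure_positive_part: "A \<in> sets borel \<Longrightarrow> emeasure (positive_part \<nu>) A = upper_variation \<nu> A"
proof -
  have sa: "sigma_algebra UNIV (sets (borel :: 'a measure))"
    using sets.sigma_algebra_axioms[of "borel :: 'a measure"] by simp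
  show "sets (positive_part \<nu>) = sets borel"
    unfolding positive_part_def
    by (subst sets_measure_of) (auto intro!: sigma_algebra.sigma_sets_eq[OF sa])
  show "space (positive_part \<nu>) = UNIV"
    unfolding positive_part_def by (subst space_measure_of) auto
  show "A \<in> sets borel \<Longrightarrow> emeasure (positive_part \<nu>) A = upper_variation \<nu> A"
    using measure_space_upper_variation[of \<nu>] unfolding positive_part_def
    by (intro emeasure_measure_of_sigma[OF sa]) (auto simp: measure_space_def)
qed

definition couplings ::
  "('a::topological_space, 'b::real_normed_vector) vmeasure \<Rightarrow> ('a \<times> 'a, 'b) vmeasure set" where
  "couplings \<mu> = {\<pi>. marginal1 \<pi> - marginal2 \<pi> = \<mu>}"

definition wass_space :: "('a::metric_space, 'b::real_normed_vector) vmeasure set" where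
  "wass_space = {\<mu>. vm \<mu> UNIV = 0 \<and>
     (\<exists>x0. (\<integral>\<^sup>+ x. ennreal (dist x x0) \<partial>total_variation \<mu>) < \<infinity>)}"

definition wass_norm :: "('a::metric_space, 'b::real_normed_vector) vmeasure \<Rightarrow> real" where
  "wass_norm \<mu> = enn2real
     (INF \<pi> \<in> couplings \<mu>. \<integral>\<^sup>+ p. ennreal (dist (fst p) (snd p)) \<partial>total_variation \<pi>)"

text \<open>
  Functionals on the Wasserstein space are functions on all vector measures which vanish outside
  that space, so that equality of functionals is equality on the space.
\<close>

definition wass_dual :: "(('a::metric_space, 'b::real_normed_vector) vmeasure \<Rightarrow> real) set" where
  "wass_dual = {\<phi>.
     (\<forall>\<mu>. \<mu> \<notin> wass_space \<longrightarrow> \<phi> \<mu> = 0) \<and>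
     (\<forall>\<mu>\<in>wass_space. \<forall>\<nu>\<in>wass_space. \<phi> (\<mu> + \<nu>) = \<phi> \<mu> + \<phi> \<nu>) \<and>
     (\<forall>c. \<forall>\<mu>\<in>wass_space. \<phi> (c *\<^sub>R \<mu>) = c * \<phi> \<mu>) \<and>
     (\<forall>\<mu>\<in>wass_space. \<forall>\<epsilon>>0. \<exists>\<delta>>0. \<forall>\<nu>\<in>wass_space. wass_norm (\<nu> - \<mu>) < \<delta> \<longrightarrow> \<bar>\<phi> \<nu> - \<phi> \<mu>\<bar> < \<epsilon>)}"

definition wass_dual_norm :: "(('a::metric_space, 'b::real_normed_vector) vmeasure \<Rightarrow> real) \<Rightarrow> real" where
  "wass_dual_norm \<phi> = (SUP \<mu> \<in> {\<mu> \<in> wass_space. wass_norm \<mu> \<le> 1}. \<bar>\<phi> \<mu>\<bar>)"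

definition lip_space :: "'a::metric_space \<Rightarrow> ('a \<Rightarrow> 'b::real_normed_vector) set" where
  "lip_space x0 = {u. u x0 = 0 \<and> (\<exists>L. L-lipschitz_on UNIV u)}"

text \<open>
  Inserting 0 changes the supremum only when the space is a single point, where it stands for
  the convention that the supremum of the empty set of nonnegative numbers is 0.
\<close>

definition lip_norm :: "('a::metric_space \<Rightarrow> 'b::real_normed_vector) \<Rightarrow> real" where
  "lip_norm u = Sup (insert 0 {norm (u x - u y) / dist x y | x y. x \<noteq> y})"

definition T_op :: "('a::metric_space \<Rightarrow> real^'m) \<Rightarrow> ('a, real^'m) vmeasure \<Rightarrow> real" where
  "T_op u \<mu> = (if \<mu> \<in> wass_space then vm_integral \<mu> u else 0)"

definition S_op :: "'a::metric_space \<Rightarrow> (('a, real^'m) vmeasure \<Rightarrow> real) \<Rightarrow> 'a \<Rightarrow> real^'m" where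
  "S_op x0 \<phi> x = (THE v. \<forall>w. v \<bullet> w = \<phi> (dirac_vm x w - dirac_vm x0 w))"

end

theory Submission
  imports Defs
begin

text \<open>
  A Lipschitz map \<open>u\<close> with constant \<open>L\<close> satisfies
  \<open>\<bar>\<integral>\<langle>u, d\<mu>\<rangle>\<bar> = \<bar>\<integral>\<langle>u x - u y, d\<pi>\<rangle>\<bar> \<le> L * \<integral>dist x y d\<parallel>\<pi>\<parallel>\<close> for every coupling
  \<open>\<pi>\<close> of \<open>\<mu>\<close> of finite cost. Taking the infimum over \<open>\<pi>\<close> shows that \<open>T u\<close> is a bounded functional
  of norm at most the Lipschitz norm of \<open>u\<close> (\<open>vm_integral_lipschitz_bound\<close>). Conversely
  \<open>(\<delta>\<^sub>x - \<delta>\<^sub>y) w\<close> has Wasserstein norm at most \<open>dist x y * norm w\<close>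
  (\<open>wass_norm_dirac_diff\<close>). Evaluating functionals on such measures bounds the difference quotients
  of \<open>S \<phi>\<close> for every \<open>\<phi>\<close> in the dual, and bounds the Lipschitz norm of \<open>u\<close> by the norm
  of \<open>T u\<close> (\<open>wass_dual_norm_T_op\<close>).

  That \<open>S (T u) = u\<close> is the computation of \<open>T u\<close> on Dirac differences. For \<open>T (S \<phi>) = \<phi>\<close>,
  the two sides agree on the measures \<open>(\<delta>\<^sub>x - \<delta>\<^sub>x\<^sub>0) w\<close>, hence on their span. That span is
  dense: if simple Borel maps \<open>F n\<close> converge to the identity, then the images of \<open>\<mu>\<close> under
  \<open>F n\<close> are combinations of Dirac differences, because \<open>\<mu>\<close> has total mass 0, and they
  converge to \<open>\<mu>\<close> in the Wasserstein norm (\<open>simple_approximation_in_wass_norm\<close>).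

  The integral against a vector measure is defined through the positive parts of the components and
  their negatives, which do not depend linearly on the measure. Two facts make it manageable. Every
  signed measure is bounded (\<open>upper_variation_finite\<close>), so Jordan's decomposition holds and the
  total variation is finite. On a simple function \<open>g\<close> the integral is the finite sum of
  \<open>y \<bullet> \<mu> (g -` {y})\<close> (\<open>vm_integral_simple_function\<close>). Linearity in the measure, the image measure
  formula and the bound by the integral of the norm hold for simple functions by inspection, and
  pass to integrable functions by dominated convergence.
\<close>

section \<open>Vector measures and their variation\<close>

lemma vm_not_borel: "A \<notin> sets borel \<Longrightarrow> vm \<mu> A = 0"
  using vm[of \<mu>] by (auto simp: vector_measure_def)

lemma vm_eqI: "(\<And>A. A \<in> sets borel \<Longrightarrow> vm \<mu> A = vm \<nu> A) \<Longrightarrow> \<mu> = \<nu>"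
  by (metis vm_inject vm_not_borel ext)

lemma vm_Diff:
  assumes "A \<in> sets borel" "B \<in> sets borel" "B \<subseteq> A"
  shows "vm \<mu> (A - B) = vm \<mu> A - vm \<mu> B"
  using vm_Un[of B "A - B" \<mu>] assms by (simp add: Un_absorb1)

lemma vm_UN_finite:
  assumes "finite I" "\<And>i. i \<in> I \<Longrightarrow> F i \<in> sets borel" "disjoint_family_on F I"
  shows "vm \<mu> (\<Union>i\<in>I. F i) = (\<Sum>i\<in>I. vm \<mu> (F i))"
  using assms
proof (induction I rule: finite_induct)
  case (insert i I)
  have "F i \<inter> (\<Union>j\<in>I. F j) = {}"
    using insert.hyps insert.prems(2) by (fastforce simp: disjoint_family_on_def)
  moreover have "disjoint_family_on F I"
    using insert.prems(2) by (auto simp: disjoint_family_on_def)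
  moreover have "(\<Union>j\<in>I. F j) \<in> sets borel"
    using insert.hyps(1) insert.prems(1) by auto
  ultimately show ?case
    using insert by (simp add: vm_Un)
qed auto

lemma variation_leI:
  assumes "\<And>P. P \<in> borel_partitions A \<Longrightarrow> (\<Sum>E\<in>P. ennreal (norm (vm \<mu> E))) \<le> c"
  shows "variation \<mu> A \<le> c"
  unfolding variation_def using assms by (rule SUP_least)

lemma norm_sum_le_variation:
  "P \<in> borel_partitions A \<Longrightarrow> (\<Sum>E\<in>P. ennreal (norm (vm \<mu> E))) \<le> variation \<mu> A"
  unfolding variation_def by (rule SUP_upper)

lemma norm_le_variation:
  "A \<in> sets borel \<Longrightarrow> ennreal (norm (vm \<mu> A)) \<le> variation \<mu> A"
  using norm_sum_le_variation[of "{A}" A \<mu>] by (simp add: borel_partitions_def)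

lemma sum_emeasure_partition:
  assumes "P \<in> borel_partitions A" "sets N = sets borel"
  shows "(\<Sum>E\<in>P. emeasure N E) = emeasure N A"
  using sum_emeasure[of "\<lambda>E. E" P N] assms
  by (auto simp: borel_partitions_def disjoint_family_on_def disjoint_def)

text \<open>
  The total variation is the smallest measure that dominates the norm of \<open>\<mu>\<close>. Upper bounds for
  the total variation of a multiple or of an image measure are obtained by exhibiting a dominating
  measure.
\<close>

lemma variation_le_emeasure:
  assumes "sets N = sets borel"
    and "\<And>A. A \<in> sets borel \<Longrightarrow> ennreal (norm (vm \<mu> A)) \<le> emeasure N A"
  shows "variation \<mu> A \<le> emeasure N A"
proof (rule variation_leI)
  fix P assume P: "P \<in> borel_partitions A"
  have "(\<Sum>E\<in>P. ennreal (norm (vm \<mu> E))) \<le> (\<Sum>E\<in>P. emeasure N E)"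
    using P assms(2) by (intro sum_mono) (auto simp: borel_partitions_def)
  then show "(\<Sum>E\<in>P. ennreal (norm (vm \<mu> E))) \<le> emeasure N A"
    by (simp add: sum_emeasure_partition[OF P assms(1)])
qed

section \<open>Boundedness and Jordan decomposition\<close>

lemma le_upper_variation:
  "B \<in> sets borel \<Longrightarrow> B \<subseteq> A \<Longrightarrow> ennreal (vm \<nu> B) \<le> upper_variation \<nu> A"
  unfolding upper_variation_def by (rule SUP_upper) auto

lemma upper_variation_Un:
  assumes "A \<in> sets borel" "B \<in> sets borel" "A \<inter> B = {}"
  shows "upper_variation \<nu> (A \<union> B) = upper_variation \<nu> A + upper_variation \<nu> B"
  using plus_emeasure[of A "positive_part \<nu>" B] assms by (simp add: emeasure_positive_part)

text \<open>
  One step of the argument for boundedness of signed measures. A set \<open>B \<subseteq> A\<close> whose measure exceeds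
  \<open>\<bar>\<nu> A\<bar> + 1\<close> has a complement in \<open>A\<close> of measure below \<open>-1\<close>, and by additivity of the
  upper variation one of the two pieces again has infinite upper variation. That piece is kept,
  and the discarded one has absolute measure at least 1.
\<close>

lemma upper_variation_infinite_split:
  fixes \<nu> :: "('a::topological_space, real) vmeasure"
  assumes A: "A \<in> sets borel" and inf: "upper_variation \<nu> A = \<infinity>"
  shows "\<exists>A'\<in>sets borel. A' \<subseteq> A \<and> upper_variation \<nu> A' = \<infinity> \<and> \<bar>vm \<nu> (A - A')\<bar> \<ge> 1"
proof -
  have "ennreal (\<bar>vm \<nu> A\<bar> + 1) < upper_variation \<nu> A" using inf by simp
  then obtain B where B: "B \<in> sets borel" "B \<subseteq> A" "ennreal (\<bar>vm \<nu> A\<bar> + 1) < ennreal (vm \<nu> B)"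
    unfolding upper_variation_def less_SUP_iff by blast
  have big: "\<bar>vm \<nu> A\<bar> + 1 < vm \<nu> B"
    using B(3) by (subst (asm) ennreal_less_iff) auto
  have diff: "vm \<nu> (A - B) = vm \<nu> A - vm \<nu> B" using A B by (intro vm_Diff)
  have "upper_variation \<nu> B + upper_variation \<nu> (A - B) = \<infinity>"
    using upper_variation_Un[of B "A - B" \<nu>] A B inf by (simp add: Un_absorb1)
  then consider "upper_variation \<nu> B = \<infinity>" | "upper_variation \<nu> (A - B) = \<infinity>"
    by (auto simp: ennreal_add_eq_top)
  then show ?thesis
  proof cases
    case 1
    then show ?thesis using B big diff by (intro bexI[of _ B]) auto
  next
    case 2
    have "A - (A - B) = B" using B by auto
    then show ?thesis using 2 A B big by (intro bexI[of _ "A - B"]) auto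
  qed
qed

text \<open>
  If the upper variation were infinite, iterating the splitting would discard infinitely many
  disjoint sets of absolute measure at least 1; but the measures of disjoint sets form a convergent
  series.
\<close>

lemma upper_variation_finite: "upper_variation \<nu> UNIV < \<infinity>"
proof (rule ccontr)
  assume "\<not> upper_variation \<nu> UNIV < \<infinity>"
  then have top: "upper_variation \<nu> UNIV = \<infinity>" using top.not_eq_extremum by (metis infinity_ennreal_def)
  define P where "P = (\<lambda>A. A \<in> sets borel \<and> upper_variation \<nu> A = \<infinity>)"
  have "\<exists>A. \<forall>n::nat. P (A n) \<and> (A (Suc n) \<subseteq> A n \<and> \<bar>vm \<nu> (A n - A (Suc n))\<bar> \<ge> 1)"
  proof (rule dependent_nat_choice)
    show "\<exists>A. P A" unfolding P_def using top by (intro exI[of _ UNIV]) auto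
    show "\<exists>B. P B \<and> B \<subseteq> A \<and> 1 \<le> \<bar>vm \<nu> (A - B)\<bar>" if "P A" for A and n :: nat
      using upper_variation_infinite_split[of A \<nu>] that by (auto simp: P_def)
  qed
  then obtain A where P: "\<And>n. P (A n)" and step: "\<And>n. A (Suc n) \<subseteq> A n"
    and ge: "\<And>n. \<bar>vm \<nu> (A n - A (Suc n))\<bar> \<ge> 1" by blast
  have dec: "A n \<subseteq> A k" if "k \<le> n" for k n
    using lift_Suc_antimono_le[of A, OF step that] .
  have "disjoint_family (\<lambda>n. A n - A (Suc n))"
    unfolding disjoint_family_on_def
  proof (intro ballI impI)
    fix k n :: nat assume "k \<noteq> n"
    then have "A n \<subseteq> A (Suc k) \<or> A k \<subseteq> A (Suc n)" using dec by (metis Suc_leI nat_neq_iff)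
    then show "(A k - A (Suc k)) \<inter> (A n - A (Suc n)) = {}" by blast
  qed
  moreover have "range (\<lambda>n. A n - A (Suc n)) \<subseteq> sets borel" using P by (auto simp: P_def)
  ultimately have "(\<lambda>n. vm \<nu> (A n - A (Suc n))) sums vm \<nu> (\<Union>n. A n - A (Suc n))"
    by (intro vm_sums)
  then have "(\<lambda>n. vm \<nu> (A n - A (Suc n))) \<longlonglongrightarrow> 0"
    by (rule summable_LIMSEQ_zero[OF sums_summable])
  then have "eventually (\<lambda>n. dist (vm \<nu> (A n - A (Suc n))) 0 < 1) sequentially"
    by (rule tendstoD) simp
  then show False using ge by (auto simp: eventually_sequentially not_le[symmetric])
qed

lemma finite_measure_positive_part: "finite_measure (positive_part \<nu>)"
  using upper_variation_finite[of \<nu>]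
  by (intro finite_measureI) (simp add: emeasure_positive_part)

text \<open>
  From \<open>\<nu> B = \<nu> A - \<nu> (A - B)\<close> the supremum of \<open>- \<nu>\<close> over the subsets of \<open>A\<close> is at most
  \<open>\<nu>\<^sup>+ A - \<nu> A\<close>. This is one inequality; the other is the same statement for \<open>- \<nu>\<close>.
\<close>

lemma jordan_decomposition:
  assumes A: "A \<in> sets borel"
  shows "vm \<nu> A = measure (positive_part \<nu>) A - measure (positive_part (- \<nu>)) A"
proof -
  have le: "vm \<nu> A + measure (positive_part (- \<nu>)) A \<le> measure (positive_part \<nu>) A"
    for \<nu> :: "('a, real) vmeasure"
  proof -
    interpret p: finite_measure "positive_part \<nu>" by (rule finite_measure_positive_part)
    interpret n: finite_measure "positive_part (- \<nu>)" by (rule finite_measure_positive_part)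
    have le_p: "vm \<nu> B \<le> measure (positive_part \<nu>) A" if "B \<in> sets borel" "B \<subseteq> A" for B
      using le_upper_variation[OF that, of \<nu>] A
      by (simp add: p.emeasure_eq_measure emeasure_positive_part[symmetric] ennreal_le_iff)
    have "upper_variation (- \<nu>) A \<le> ennreal (measure (positive_part \<nu>) A - vm \<nu> A)"
      unfolding upper_variation_def
    proof (rule SUP_least, rule ennreal_leI, clarify)
      fix B assume B: "B \<in> sets borel" "B \<subseteq> A"
      have "vm \<nu> (A - B) \<le> measure (positive_part \<nu>) A" using A B by (intro le_p) auto
      then show "vm (- \<nu>) B \<le> measure (positive_part \<nu>) A - vm \<nu> A"
        using vm_Diff[OF A B, of \<nu>] by (simp add: uminus_vmeasure.rep_eq)
    qed
    moreover have "vm \<nu> A \<le> measure (positive_part \<nu>) A" using A by (intro le_p) auto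
    ultimately show ?thesis
      using A by (simp add: n.emeasure_eq_measure emeasure_positive_part[symmetric] ennreal_le_iff)
  qed
  show ?thesis
    using le[of \<nu>] le[of "- \<nu>"] by (simp add: uminus_vmeasure.rep_eq)
qed

lemma component_vm_nth: "vm (component_vm i \<mu>) A = vm \<mu> A $ i"
  by (simp add: component_vm.rep_eq)

text \<open>
  This makes every function that is integrable for the total variation integrable for all the
  positive measures that enter the integral with respect to \<open>\<mu>\<close>.
\<close>

lemma upper_variation_component_le:
  fixes \<mu> :: "('a::topological_space, real^'m) vmeasure"
  assumes "A \<in> sets borel"
  shows "upper_variation (component_vm i \<mu>) A \<le> variation \<mu> A"
    and "upper_variation (- component_vm i \<mu>) A \<le> variation \<mu> A"
proof -
  have *: "ennreal \<bar>vm \<mu> B $ i\<bar> \<le> variation \<mu> A" if B: "B \<in> sets borel" "B \<subseteq> A" for B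
  proof -
    have "ennreal \<bar>vm \<mu> B $ i\<bar> \<le> ennreal (norm (vm \<mu> B))"
      by (intro ennreal_leI component_le_norm_cart)
    also have "\<dots> \<le> emeasure (total_variation \<mu>) B"
      using norm_le_variation[OF B(1)] B by (simp add: emeasure_total_variation)
    also have "\<dots> \<le> emeasure (total_variation \<mu>) A"
      using B assms by (intro emeasure_mono) auto
    finally show ?thesis using assms by (simp add: emeasure_total_variation)
  qed
  show "upper_variation (component_vm i \<mu>) A \<le> variation \<mu> A"
    unfolding upper_variation_def
  proof (rule SUP_least, clarify)
    fix B assume B: "B \<in> sets borel" "B \<subseteq> A"
    have "ennreal (vm (component_vm i \<mu>) B) \<le> ennreal \<bar>vm \<mu> B $ i\<bar>"
      by (intro ennreal_leI) (simp add: component_vm_nth)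
    then show "ennreal (vm (component_vm i \<mu>) B) \<le> variation \<mu> A"
      using *[OF B] by (rule order_trans)
  qed
  show "upper_variation (- component_vm i \<mu>) A \<le> variation \<mu> A"
    unfolding upper_variation_def
  proof (rule SUP_least, clarify)
    fix B assume B: "B \<in> sets borel" "B \<subseteq> A"
    have "ennreal (vm (- component_vm i \<mu>) B) \<le> ennreal \<bar>vm \<mu> B $ i\<bar>"
      by (intro ennreal_leI) (simp add: component_vm_nth uminus_vmeasure.rep_eq)
    then show "ennreal (vm (- component_vm i \<mu>) B) \<le> variation \<mu> A"
      using *[OF B] by (rule order_trans)
  qed
qed

lemma finite_measure_total_variation:
  fixes \<mu> :: "('a::topological_space, real^'m) vmeasure"
  shows "finite_measure (total_variation \<mu>)"
proof (rule finite_measureI)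
  let ?p = "\<lambda>i. positive_part (component_vm i \<mu>)" and ?n = "\<lambda>i. positive_part (- component_vm i \<mu>)"
  \<comment> \<open>The \<open>l1\<close> norm of the components suffices, as only finiteness is claimed.\<close>
  have norm_le: "ennreal (norm (vm \<mu> E)) \<le> (\<Sum>i\<in>UNIV. emeasure (?p i) E + emeasure (?n i) E)"
    if E: "E \<in> sets borel" for E
  proof -
    have "\<bar>vm \<mu> E $ i\<bar> \<le> measure (?p i) E + measure (?n i) E" for i
      using jordan_decomposition[OF E, of "component_vm i \<mu>"]
        measure_nonneg[of "?p i" E] measure_nonneg[of "?n i" E]
      unfolding component_vm_nth by linarith
    then have "norm (vm \<mu> E) \<le> (\<Sum>i\<in>UNIV. measure (?p i) E + measure (?n i) E)"
      by (intro order_trans[OF norm_le_l1_cart] sum_mono)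
    then have "ennreal (norm (vm \<mu> E)) \<le> ennreal (\<Sum>i\<in>UNIV. measure (?p i) E + measure (?n i) E)"
      by (rule ennreal_leI)
    also have "\<dots> = (\<Sum>i\<in>UNIV. emeasure (?p i) E + emeasure (?n i) E)"
      by (simp add: finite_measure.emeasure_eq_measure[OF finite_measure_positive_part]
          flip: sum_ennreal ennreal_plus)
    finally show ?thesis .
  qed
  have "variation \<mu> UNIV \<le> (\<Sum>i\<in>UNIV. emeasure (?p i) UNIV + emeasure (?n i) UNIV)"
  proof (rule variation_leI)
    fix P :: "'a set set" assume P: "P \<in> borel_partitions UNIV"
    have "(\<Sum>E\<in>P. ennreal (norm (vm \<mu> E))) \<le>
        (\<Sum>E\<in>P. \<Sum>i\<in>UNIV. emeasure (?p i) E + emeasure (?n i) E)"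
      using P by (intro sum_mono norm_le) (auto simp: borel_partitions_def)
    also have "\<dots> = (\<Sum>i\<in>UNIV. emeasure (?p i) UNIV + emeasure (?n i) UNIV)"
      by (subst sum.swap) (simp add: sum.distrib sum_emeasure_partition[OF P])
    finally show "(\<Sum>E\<in>P. ennreal (norm (vm \<mu> E))) \<le>
        (\<Sum>i\<in>UNIV. emeasure (?p i) UNIV + emeasure (?n i) UNIV)" .
  qed
  also have "\<dots> < \<infinity>"
    by (auto simp: emeasure_positive_part intro: upper_variation_finite[simplified])
  finally show "emeasure (total_variation \<mu>) (space (total_variation \<mu>)) \<noteq> \<infinity>"
    by (simp add: emeasure_total_variation)
qed

section \<open>Integration against vector measures\<close>

text \<open>
  Domination of measures is inherited by integrals because it is visible on simple functions; no
  measure representing the sum of \<open>N\<close> and \<open>N'\<close> has to be formed.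
\<close>

lemma nn_integral_le_add_measure:
  assumes sets: "sets N = sets M" "sets N' = sets M"
    and le: "\<And>A. A \<in> sets M \<Longrightarrow> emeasure M A \<le> emeasure N A + emeasure N' A"
  shows "nn_integral M f \<le> nn_integral N f + nn_integral N' f"
  unfolding nn_integral_def[of M]
proof (rule SUP_least, clarify)
  fix g :: "'a \<Rightarrow> ennreal" assume g: "simple_function M g" "g \<le> f"
  note space = sets_eq_imp_space_eq[OF sets(1)] sets_eq_imp_space_eq[OF sets(2)]
  have gN: "simple_function N g" "simple_function N' g"
    using g(1) sets space by (simp_all add: simple_function_def)
  have "integral\<^sup>S M g \<le> integral\<^sup>S N g + integral\<^sup>S N' g"
    unfolding simple_integral_def space sum.distrib[symmetric] distrib_left[symmetric]
    using g(1) by (intro sum_mono mult_left_mono le) (auto simp: simple_function_def)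
  also have "\<dots> \<le> nn_integral N f + nn_integral N' f"
    using g(2) gN
    by (intro add_mono) (auto simp: nn_integral_eq_simple_integral[symmetric] le_fun_def intro: nn_integral_mono)
  finally show "integral\<^sup>S M g \<le> nn_integral N f + nn_integral N' f" .
qed

lemma nn_integral_le_measure:
  assumes sets: "sets N = sets M"
    and le: "\<And>A. A \<in> sets M \<Longrightarrow> emeasure M A \<le> emeasure N A"
  shows "nn_integral M f \<le> nn_integral N f"
  using nn_integral_le_add_measure[of N M "null_measure M" f] assms
  by (simp add: nn_integral_null_measure)

lemma borel_measurable_total_variation:
  "g \<in> borel_measurable (total_variation \<mu>) \<longleftrightarrow> g \<in> borel_measurable borel"
  using measurable_cong_sets[OF sets_total_variation refl] by blast

lemma nn_integral_component_le:
  assumes "M \<in> {positive_part (component_vm i \<mu>), positive_part (- component_vm i \<mu>)}"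
  shows "nn_integral M f \<le> nn_integral (total_variation \<mu>) f"
  using assms
  by (auto intro!: nn_integral_le_measure
      simp: emeasure_positive_part emeasure_total_variation upper_variation_component_le)

lemma integrable_component:
  fixes f :: "'a::topological_space \<Rightarrow> 'b::{banach, second_countable_topology}"
  assumes "M \<in> {positive_part (component_vm i \<mu>), positive_part (- component_vm i \<mu>)}"
    and f: "integrable (total_variation \<mu>) f"
  shows "integrable M f"
proof (rule integrableI_bounded)
  have sets: "sets M = sets borel" using assms(1) by auto
  show "f \<in> borel_measurable M"
    using borel_measurable_integrable[OF f] measurable_cong_sets[OF sets_total_variation refl]
      measurable_cong_sets[OF sets refl] by blast
  show "(\<integral>\<^sup>+ x. ennreal (norm (f x)) \<partial>M) < \<infinity>"
    using nn_integral_component_le[OF assms(1)] f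
    by (auto simp: integrable_iff_bounded intro: le_less_trans)
qed

lemma vm_integrableI:
  assumes g: "integrable (total_variation \<mu>) g"
  shows "vm_integrable \<mu> g"
  unfolding vm_integrable_def signed_integrable_def
proof (intro allI conjI)
  fix i
  note bl = bounded_linear_vec_nth[of i]
  show "integrable (positive_part (component_vm i \<mu>)) (\<lambda>x. g x $ i)"
    by (rule integrable_bounded_linear[OF bl integrable_component[OF _ g, of _ i]]) simp
  show "integrable (positive_part (- component_vm i \<mu>)) (\<lambda>x. g x $ i)"
    by (rule integrable_bounded_linear[OF bl integrable_component[OF _ g, of _ i]]) simp
qed

lemma vm_integral_add:
  assumes "vm_integrable \<mu> f" "vm_integrable \<mu> g"
  shows "vm_integral \<mu> (\<lambda>x. f x + g x) = vm_integral \<mu> f + vm_integral \<mu> g"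
  using assms
  by (simp add: vm_integral_def vm_integrable_def signed_integral_def signed_integrable_def
      sum.distrib[symmetric] algebra_simps)

lemma vm_integral_scaleR:
  "vm_integral \<mu> (\<lambda>x. c *\<^sub>R g x) = c * vm_integral \<mu> g"
  by (simp add: vm_integral_def signed_integral_def sum_distrib_left algebra_simps)

lemma vm_integral_diff:
  assumes "vm_integrable \<mu> f" "vm_integrable \<mu> g"
  shows "vm_integral \<mu> (\<lambda>x. f x - g x) = vm_integral \<mu> f - vm_integral \<mu> g"
  using assms
  by (simp add: vm_integral_def vm_integrable_def signed_integral_def signed_integrable_def
      sum_subtractf[symmetric] algebra_simps)

lemma vm_integral_dominated_convergence:
  fixes \<mu> :: "('a::topological_space, real^'m) vmeasure"
  assumes w: "integrable (total_variation \<mu>) w"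
    and F: "\<And>n. F n \<in> borel_measurable borel" and g: "g \<in> borel_measurable borel"
    and lim: "\<And>x. (\<lambda>n. F n x) \<longlonglongrightarrow> g x"
    and bound: "\<And>n x. norm (F n x) \<le> w x"
  shows "(\<lambda>n. vm_integral \<mu> (F n)) \<longlonglongrightarrow> vm_integral \<mu> g"
  unfolding vm_integral_def signed_integral_def
proof (intro tendsto_sum tendsto_diff)
  fix i
  have *: "(\<lambda>n. \<integral>x. F n x $ i \<partial>M) \<longlonglongrightarrow> (\<integral>x. g x $ i \<partial>M)"
    if M: "M \<in> {positive_part (component_vm i \<mu>), positive_part (- component_vm i \<mu>)}" for M
  proof (rule integral_dominated_convergence)
    have [measurable_cong]: "sets M = sets borel" using M by auto
    have nth: "(\<lambda>v::real^'m. v $ i) \<in> borel_measurable borel"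
      by (intro borel_measurable_continuous_onI continuous_intros)
    note [measurable] = F g
    show "(\<lambda>x. g x $ i) \<in> borel_measurable M" "\<And>n. (\<lambda>x. F n x $ i) \<in> borel_measurable M"
      by (rule measurable_compose[OF _ nth], measurable)+
    show "integrable M w" by (rule integrable_component[OF M w])
    show "AE x in M. (\<lambda>n. F n x $ i) \<longlonglongrightarrow> g x $ i"
      using lim by (intro AE_I2 tendsto_vec_nth)
    show "AE x in M. norm (F n x $ i) \<le> w x" for n
      using bound[of n] by (intro AE_I2 order_trans[OF Finite_Cartesian_Product.norm_nth_le])
  qed
  show "(\<lambda>n. \<integral>x. F n x $ i \<partial>positive_part (component_vm i \<mu>))
      \<longlonglongrightarrow> (\<integral>x. g x $ i \<partial>positive_part (component_vm i \<mu>))"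
    by (rule *) simp
  show "(\<lambda>n. \<integral>x. F n x $ i \<partial>positive_part (- component_vm i \<mu>))
      \<longlonglongrightarrow> (\<integral>x. g x $ i \<partial>positive_part (- component_vm i \<mu>))"
    by (rule *) simp
qed

lemma simple_function_borelD:
  assumes "simple_function borel g"
  shows "finite (range g)" "g -` {y} \<in> sets borel"
proof -
  show "finite (range g)" using assms by (simp add: simple_function_def)
  show "g -` {y} \<in> sets borel"
    using simple_functionD(2)[OF assms, of "{y}"] by simp
qed

lemma integral_comp_simple_function:
  fixes h :: "'b \<Rightarrow> real"
  assumes M: "finite_measure M" "sets M = sets borel" and g: "simple_function borel g"
  shows "(\<integral>x. h (g x) \<partial>M) = (\<Sum>y\<in>range g. h y * measure M (g -` {y}))"
proof -
  interpret finite_measure M by fact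
  have "h (g x) = (\<Sum>y\<in>range g. h y * indicator (g -` {y}) x)" for x
    using simple_function_borelD(1)[OF g]
    by (subst sum.remove[of _ "g x"]) (auto simp: indicator_def intro!: sum.neutral)
  then have "(\<integral>x. h (g x) \<partial>M) = (\<integral>x. (\<Sum>y\<in>range g. h y * indicator (g -` {y}) x) \<partial>M)"
    by simp
  also have "\<dots> = (\<Sum>y\<in>range g. h y * measure M (g -` {y}))"
    using simple_function_borelD(2)[OF g] M(2) sets_eq_imp_space_eq[OF M(2)]
    by (subst Bochner_Integration.integral_sum)
      (auto simp: emeasure_eq_measure intro!: integrable_mult_right integrable_real_indicator)
  finally show ?thesis .
qed

text \<open>
  On simple functions the integral depends linearly on \<open>\<mu>\<close> itself, although the positive part
  does not. Together with dominated convergence this formula yields every property of the integral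
  as a function of the measure.
\<close>

lemma vm_integral_simple_function:
  fixes g :: "'a::topological_space \<Rightarrow> real^'m"
  assumes g: "simple_function borel g"
  shows "vm_integral \<mu> g = (\<Sum>y\<in>range g. y \<bullet> vm \<mu> (g -` {y}))"
proof -
  have "signed_integral (component_vm i \<mu>) (\<lambda>x. g x $ i)
      = (\<Sum>y\<in>range g. y $ i * vm \<mu> (g -` {y}) $ i)" for i
    using integral_comp_simple_function[OF finite_measure_positive_part sets_positive_part g,
        of "component_vm i \<mu>" "\<lambda>y. y $ i"]
      integral_comp_simple_function[OF finite_measure_positive_part sets_positive_part g,
        of "- component_vm i \<mu>" "\<lambda>y. y $ i"]
      jordan_decomposition[OF simple_function_borelD(2)[OF g], of "component_vm i \<mu>"]
    by (simp add: signed_integral_def component_vm_nth sum_subtractf[symmetric]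
        right_diff_distrib[symmetric])
  then show ?thesis
    unfolding vm_integral_def by (simp add: inner_vec_def) (rule sum.swap)
qed

lemma simple_function_approximation:
  fixes g :: "'a::topological_space \<Rightarrow> 'b::{metric_space, second_countable_topology}"
  assumes "g \<in> borel_measurable borel"
  obtains F where "\<And>n. simple_function borel (F n)" "\<And>n. F n \<in> borel_measurable borel"
    "\<And>x. (\<lambda>n. F n x) \<longlonglongrightarrow> g x" "\<And>n x. dist (F n x) z \<le> 2 * dist (g x) z"
  using borel_measurable_implies_sequence_metric[OF assms, of z] borel_measurable_simple_function
  by auto

text \<open>
  The form in which dominated convergence is applied to the simple approximations, whose norms are
  bounded by twice the norm of the limit.
\<close>

lemma vm_integral_simple_limit:
  fixes \<mu> :: "('a::topological_space, real^'m) vmeasure"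
  assumes g: "integrable (total_variation \<mu>) g"
    and F: "\<And>n. F n \<in> borel_measurable borel" "\<And>x. (\<lambda>n. F n x) \<longlonglongrightarrow> g x"
      "\<And>n x. dist (F n x) 0 \<le> 2 * dist (g x) 0"
  shows "(\<lambda>n. vm_integral \<mu> (F n)) \<longlonglongrightarrow> vm_integral \<mu> g"
proof (rule vm_integral_dominated_convergence)
  show "integrable (total_variation \<mu>) (\<lambda>x. 2 * norm (g x))" using g by simp
  show "g \<in> borel_measurable borel"
    using borel_measurable_integrable[OF g] by (simp add: borel_measurable_total_variation)
qed (use F in auto)

text \<open>
  The Euclidean norm must appear here without a dimensional constant, so the estimate cannot be
  made component by component. On simple functions it is the Cauchy-Schwarz inequality applied to
  each level set.
\<close>

lemma vm_integral_bound:
  fixes \<mu> :: "('a::topological_space, real^'m) vmeasure"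
  assumes g: "integrable (total_variation \<mu>) g"
  shows "\<bar>vm_integral \<mu> g\<bar> \<le> (\<integral>x. norm (g x) \<partial>total_variation \<mu>)"
proof -
  interpret finite_measure "total_variation \<mu>" by (rule finite_measure_total_variation)
  have gm: "g \<in> borel_measurable borel"
    using borel_measurable_integrable[OF g] by (simp add: borel_measurable_total_variation)
  obtain F where simple: "\<And>n. simple_function borel (F n)"
    and F: "\<And>n. F n \<in> borel_measurable borel" "\<And>x. (\<lambda>n. F n x) \<longlonglongrightarrow> g x"
      "\<And>n x. dist (F n x) 0 \<le> 2 * dist (g x) 0"
    using simple_function_approximation[OF gm, of 0] by blast
  have "\<bar>vm_integral \<mu> (F n)\<bar> \<le> (\<integral>x. norm (F n x) \<partial>total_variation \<mu>)" for n
  proof -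
    have "\<bar>y \<bullet> vm \<mu> (F n -` {y})\<bar> \<le> norm y * measure (total_variation \<mu>) (F n -` {y})" for y
    proof -
      have "ennreal (norm (vm \<mu> (F n -` {y}))) \<le> ennreal (measure (total_variation \<mu>) (F n -` {y}))"
        using norm_le_variation simple_function_borelD(2)[OF simple]
        by (metis emeasure_eq_measure emeasure_total_variation)
      then have "norm (vm \<mu> (F n -` {y})) \<le> measure (total_variation \<mu>) (F n -` {y})"
        by (simp add: ennreal_le_iff)
      then show ?thesis
        by (intro order_trans[OF Cauchy_Schwarz_ineq2] mult_left_mono) auto
    qed
    then show ?thesis
      unfolding vm_integral_simple_function[OF simple]
        integral_comp_simple_function[OF finite_measure_total_variation sets_total_variation simple, where h = norm]
      by (intro order_trans[OF sum_abs] sum_mono)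
  qed
  moreover have "(\<lambda>n. \<bar>vm_integral \<mu> (F n)\<bar>) \<longlonglongrightarrow> \<bar>vm_integral \<mu> g\<bar>"
    by (intro tendsto_rabs vm_integral_simple_limit[OF g F])
  moreover have "(\<lambda>n. \<integral>x. norm (F n x) \<partial>total_variation \<mu>) \<longlonglongrightarrow> (\<integral>x. norm (g x) \<partial>total_variation \<mu>)"
  proof (rule integral_dominated_convergence)
    show "integrable (total_variation \<mu>) (\<lambda>x. 2 * norm (g x))" using g by simp
  qed (use F gm in \<open>auto intro!: tendsto_norm borel_measurable_norm simp: borel_measurable_total_variation\<close>)
  ultimately show ?thesis by (intro LIMSEQ_le[of _ "\<bar>vm_integral \<mu> g\<bar>"]) auto
qed

section \<open>Linearity in the measure\<close>

lemma variation_add_le: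
  assumes "A \<in> sets borel"
  shows "variation (\<mu> + \<nu>) A \<le> variation \<mu> A + variation \<nu> A"
proof (rule variation_leI)
  fix P assume P: "P \<in> borel_partitions A"
  have "(\<Sum>E\<in>P. ennreal (norm (vm (\<mu> + \<nu>) E))) \<le>
      (\<Sum>E\<in>P. ennreal (norm (vm \<mu> E)) + ennreal (norm (vm \<nu> E)))"
    by (intro sum_mono) (simp add: plus_vmeasure.rep_eq norm_triangle_ineq flip: ennreal_plus)
  also have "\<dots> \<le> variation \<mu> A + variation \<nu> A"
    unfolding sum.distrib by (intro add_mono norm_sum_le_variation P)
  finally show "(\<Sum>E\<in>P. ennreal (norm (vm (\<mu> + \<nu>) E))) \<le> variation \<mu> A + variation \<nu> A" .
qed

lemma nn_integral_total_variation_add_le: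
  "nn_integral (total_variation (\<mu> + \<nu>)) f
    \<le> nn_integral (total_variation \<mu>) f + nn_integral (total_variation \<nu>) f"
  by (rule nn_integral_le_add_measure) (auto simp: emeasure_total_variation variation_add_le)

lemma nn_integral_total_variation_scaleR_le:
  assumes f: "f \<in> borel_measurable borel"
  shows "nn_integral (total_variation (c *\<^sub>R \<mu>)) f \<le> ennreal \<bar>c\<bar> * nn_integral (total_variation \<mu>) f"
proof -
  have "nn_integral (total_variation (c *\<^sub>R \<mu>)) f
      \<le> nn_integral (scale_measure (ennreal \<bar>c\<bar>) (total_variation \<mu>)) f"
  proof (rule nn_integral_le_measure)
    fix A assume "A \<in> sets (total_variation (c *\<^sub>R \<mu>))"
    then have A: "A \<in> sets borel" by simp
    have "variation (c *\<^sub>R \<mu>) A \<le> emeasure (scale_measure (ennreal \<bar>c\<bar>) (total_variation \<mu>)) A"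
      by (rule variation_le_emeasure)
        (auto simp: scaleR_vmeasure.rep_eq ennreal_mult emeasure_total_variation
          intro!: mult_left_mono norm_le_variation)
    then show "emeasure (total_variation (c *\<^sub>R \<mu>)) A
        \<le> emeasure (scale_measure (ennreal \<bar>c\<bar>) (total_variation \<mu>)) A"
      using A by (simp add: emeasure_total_variation)
  qed simp
  also have "\<dots> = ennreal \<bar>c\<bar> * nn_integral (total_variation \<mu>) f"
    using f by (intro nn_integral_scale_measure) (simp add: borel_measurable_total_variation)
  finally show ?thesis .
qed

lemma integrable_total_variation_le:
  fixes f :: "'a::topological_space \<Rightarrow> 'b::{banach, second_countable_topology}"
  assumes "f \<in> borel_measurable borel"
    and "(\<integral>\<^sup>+x. ennreal (norm (f x)) \<partial>total_variation \<mu>) < \<infinity>"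
  shows "integrable (total_variation \<mu>) f"
  using assms by (intro integrableI_bounded) (auto simp: borel_measurable_total_variation)

lemma integrable_total_variation_add:
  fixes f :: "'a::topological_space \<Rightarrow> 'b::{banach, second_countable_topology}"
  assumes "integrable (total_variation \<mu>) f" "integrable (total_variation \<nu>) f"
  shows "integrable (total_variation (\<mu> + \<nu>)) f"
proof (rule integrable_total_variation_le)
  show "f \<in> borel_measurable borel"
    using borel_measurable_integrable[OF assms(1)] by (simp add: borel_measurable_total_variation)
  show "(\<integral>\<^sup>+x. ennreal (norm (f x)) \<partial>total_variation (\<mu> + \<nu>)) < \<infinity>"
    using assms by (intro le_less_trans[OF nn_integral_total_variation_add_le]) (auto simp: integrable_iff_bounded)
qed

lemma integrable_total_variation_scaleR:
  fixes f :: "'a::topological_space \<Rightarrow> 'b::{banach, second_countable_topology}"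
  assumes "integrable (total_variation \<mu>) f"
  shows "integrable (total_variation (c *\<^sub>R \<mu>)) f"
proof (rule integrable_total_variation_le)
  show f: "f \<in> borel_measurable borel"
    using borel_measurable_integrable[OF assms(1)] by (simp add: borel_measurable_total_variation)
  show "(\<integral>\<^sup>+x. ennreal (norm (f x)) \<partial>total_variation (c *\<^sub>R \<mu>)) < \<infinity>"
    using assms f
    by (intro le_less_trans[OF nn_integral_total_variation_scaleR_le])
      (auto simp: integrable_iff_bounded ennreal_mult_less_top)
qed

lemma vm_integral_measure_add:
  fixes \<mu> :: "('a::topological_space, real^'m) vmeasure"
  assumes g: "integrable (total_variation \<mu>) g" "integrable (total_variation \<nu>) g"
  shows "vm_integral (\<mu> + \<nu>) g = vm_integral \<mu> g + vm_integral \<nu> g"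
proof -
  have gm: "g \<in> borel_measurable borel"
    using borel_measurable_integrable[OF g(1)] by (simp add: borel_measurable_total_variation)
  obtain F where simple: "\<And>n. simple_function borel (F n)"
    and F: "\<And>n. F n \<in> borel_measurable borel" "\<And>x. (\<lambda>n. F n x) \<longlonglongrightarrow> g x"
      "\<And>n x. dist (F n x) 0 \<le> 2 * dist (g x) 0"
    using simple_function_approximation[OF gm, of 0] by blast
  have "vm_integral (\<mu> + \<nu>) (F n) = vm_integral \<mu> (F n) + vm_integral \<nu> (F n)" for n
    by (simp add: vm_integral_simple_function[OF simple] plus_vmeasure.rep_eq inner_add_right sum.distrib)
  then have "(\<lambda>n. vm_integral (\<mu> + \<nu>) (F n)) \<longlonglongrightarrow> vm_integral \<mu> g + vm_integral \<nu> g"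
    using tendsto_add[OF vm_integral_simple_limit[OF g(1) F] vm_integral_simple_limit[OF g(2) F]] by simp
  then show ?thesis
    using vm_integral_simple_limit[OF integrable_total_variation_add[OF g] F] LIMSEQ_unique by blast
qed

lemma vm_integral_measure_scaleR:
  fixes \<mu> :: "('a::topological_space, real^'m) vmeasure"
  assumes g: "integrable (total_variation \<mu>) g"
  shows "vm_integral (c *\<^sub>R \<mu>) g = c * vm_integral \<mu> g"
proof -
  have gm: "g \<in> borel_measurable borel"
    using borel_measurable_integrable[OF g] by (simp add: borel_measurable_total_variation)
  obtain F where simple: "\<And>n. simple_function borel (F n)"
    and F: "\<And>n. F n \<in> borel_measurable borel" "\<And>x. (\<lambda>n. F n x) \<longlonglongrightarrow> g x"
      "\<And>n x. dist (F n x) 0 \<le> 2 * dist (g x) 0"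
    using simple_function_approximation[OF gm, of 0] by blast
  have "vm_integral (c *\<^sub>R \<mu>) (F n) = c * vm_integral \<mu> (F n)" for n
    by (simp add: vm_integral_simple_function[OF simple] scaleR_vmeasure.rep_eq sum_distrib_left)
  then have "(\<lambda>n. vm_integral (c *\<^sub>R \<mu>) (F n)) \<longlonglongrightarrow> c * vm_integral \<mu> g"
    using tendsto_mult_left[OF vm_integral_simple_limit[OF g F]] by simp
  then show ?thesis
    using vm_integral_simple_limit[OF integrable_total_variation_scaleR[OF g] F] LIMSEQ_unique by blast
qed

lemma vm_integral_measure_diff:
  fixes \<mu> :: "('a::topological_space, real^'m) vmeasure"
  assumes "integrable (total_variation \<mu>) g" "integrable (total_variation \<nu>) g"
  shows "vm_integral (\<mu> - \<nu>) g = vm_integral \<mu> g - vm_integral \<nu> g"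
proof -
  have "\<mu> - \<nu> = \<mu> + (-1) *\<^sub>R \<nu>" by simp
  then show ?thesis
    using assms by (simp only: vm_integral_measure_add integrable_total_variation_scaleR
      vm_integral_measure_scaleR)
qed

section \<open>Image measures and Dirac measures\<close>

text \<open>
  The case distinction on \<open>f\<close> makes the image of every vector measure countably additive, as the
  type requires; for a map that is not Borel measurable it is the zero measure.
\<close>

lift_definition push_vm ::
  "('a::topological_space \<Rightarrow> 'c::topological_space) \<Rightarrow> ('a, 'b::real_normed_vector) vmeasure \<Rightarrow> ('c, 'b) vmeasure"
  is "\<lambda>f \<mu> A. if f \<in> borel_measurable borel \<and> A \<in> sets borel then \<mu> (f -` A) else 0"
proof (subst vector_measure_def, intro conjI allI impI)
  fix f :: "'a \<Rightarrow> 'c" and \<mu> :: "'a set \<Rightarrow> 'b" and E :: "nat \<Rightarrow> 'c set"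
  assume \<mu>: "vector_measure \<mu>" and E: "range E \<subseteq> sets borel" "disjoint_family E"
  show "(\<lambda>n. if f \<in> borel_measurable borel \<and> E n \<in> sets borel then \<mu> (f -` E n) else 0) sums
      (if f \<in> borel_measurable borel \<and> \<Union> (range E) \<in> sets borel then \<mu> (f -` \<Union> (range E)) else 0)"
  proof (cases "f \<in> borel_measurable borel")
    case True
    have "range (\<lambda>n. f -` E n) \<subseteq> sets borel"
      using E(1) measurable_sets[OF True] by auto
    moreover have "disjoint_family (\<lambda>n. f -` E n)"
      using E(2) by (auto simp: disjoint_family_on_def)
    ultimately have "(\<lambda>n. \<mu> (f -` E n)) sums \<mu> (\<Union>n. f -` E n)"
      using \<mu> by (simp add: vector_measure_def)
    moreover have "E n \<in> sets borel" for n using E(1) by auto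
    moreover have "(\<Union>n. E n) \<in> sets borel" using E(1) by auto
    ultimately show ?thesis using True by (simp add: vimage_UN)
  qed simp
qed auto

lemma vm_push:
  "f \<in> borel_measurable borel \<Longrightarrow> A \<in> sets borel \<Longrightarrow> vm (push_vm f \<mu>) A = vm \<mu> (f -` A)"
  by (simp add: push_vm.rep_eq)

lemma nn_integral_push_le:
  assumes f: "f \<in> borel_measurable borel" and h: "h \<in> borel_measurable borel"
  shows "nn_integral (total_variation (push_vm f \<mu>)) h \<le> (\<integral>\<^sup>+x. h (f x) \<partial>total_variation \<mu>)"
proof -
  have f': "f \<in> measurable (total_variation \<mu>) borel"
    using f by (simp add: borel_measurable_total_variation)
  have "nn_integral (total_variation (push_vm f \<mu>)) h
      \<le> nn_integral (distr (total_variation \<mu>) borel f) h"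
  proof (rule nn_integral_le_measure)
    fix A assume "A \<in> sets (total_variation (push_vm f \<mu>))"
    then have A: "A \<in> sets borel" by simp
    have "variation (push_vm f \<mu>) A \<le> emeasure (distr (total_variation \<mu>) borel f) A"
    proof (rule variation_le_emeasure)
      fix B :: "'b set" assume B: "B \<in> sets borel"
      have "f -` B \<in> sets borel" using measurable_sets[OF f B] by simp
      then show "ennreal (norm (vm (push_vm f \<mu>) B)) \<le> emeasure (distr (total_variation \<mu>) borel f) B"
        using B f by (simp add: vm_push emeasure_distr[OF f'] emeasure_total_variation norm_le_variation)
    qed simp
    then show "emeasure (total_variation (push_vm f \<mu>)) A \<le> emeasure (distr (total_variation \<mu>) borel f) A"
      using A by (simp add: emeasure_total_variation)
  qed simp
  also have "\<dots> = (\<integral>\<^sup>+x. h (f x) \<partial>total_variation \<mu>)"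
    using h by (intro nn_integral_distr[OF f']) simp
  finally show ?thesis .
qed

lemma integrable_push:
  fixes g :: "'c::topological_space \<Rightarrow> 'e::{banach, second_countable_topology}"
  assumes f: "f \<in> borel_measurable borel" and gm: "g \<in> borel_measurable borel"
    and g: "integrable (total_variation \<mu>) (\<lambda>x. g (f x))"
  shows "integrable (total_variation (push_vm f \<mu>)) g"
proof (rule integrable_total_variation_le[OF gm])
  have "(\<integral>\<^sup>+x. ennreal (norm (g x)) \<partial>total_variation (push_vm f \<mu>))
      \<le> (\<integral>\<^sup>+x. ennreal (norm (g (f x))) \<partial>total_variation \<mu>)"
    using gm by (intro nn_integral_push_le f) measurable
  then show "(\<integral>\<^sup>+x. ennreal (norm (g x)) \<partial>total_variation (push_vm f \<mu>)) < \<infinity>"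
    using g by (auto simp: integrable_iff_bounded)
qed

lemma vm_integral_push:
  fixes \<mu> :: "('a::topological_space, real^'m) vmeasure" and f :: "'a \<Rightarrow> 'c::topological_space"
  assumes f: "f \<in> borel_measurable borel" and gm: "g \<in> borel_measurable borel"
    and g: "integrable (total_variation \<mu>) (\<lambda>x. g (f x))"
  shows "vm_integral (push_vm f \<mu>) g = vm_integral \<mu> (\<lambda>x. g (f x))"
proof -
  note gi = integrable_push[OF assms]
  obtain F where simple: "\<And>n. simple_function borel (F n)"
    and F: "\<And>n. F n \<in> borel_measurable borel" "\<And>x. (\<lambda>n. F n x) \<longlonglongrightarrow> g x"
      "\<And>n x. dist (F n x) 0 \<le> 2 * dist (g x) 0"
    using simple_function_approximation[OF gm, of 0] by blast
  have Ff: "(\<lambda>x. F n (f x)) \<in> borel_measurable borel" for n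
    using measurable_compose[OF f F(1)] .
  have "vm_integral (push_vm f \<mu>) (F n) = vm_integral \<mu> (\<lambda>x. F n (f x))" for n
  proof -
    have fin: "finite (range (F n))" by (rule simple_function_borelD(1)[OF simple])
    have "simple_function borel (\<lambda>x. F n (f x))"
      using finite_subset[OF _ fin, of "range (\<lambda>x. F n (f x))"] Ff
      by (intro simple_function_borel_measurable) auto
    then have "vm_integral \<mu> (\<lambda>x. F n (f x))
        = (\<Sum>y\<in>range (\<lambda>x. F n (f x)). y \<bullet> vm \<mu> (f -` (F n -` {y})))"
      by (subst vm_integral_simple_function) (auto simp: vimage_def)
    also have "\<dots> = (\<Sum>y\<in>range (F n). y \<bullet> vm \<mu> (f -` (F n -` {y})))"
    proof (rule sum.mono_neutral_left[OF fin]; safe)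
      fix x assume "F n x \<notin> range (\<lambda>x. F n (f x))"
      then have "f -` (F n -` {F n x}) = {}"
        unfolding vimage_def by (metis (mono_tags, lifting) Collect_empty_eq mem_Collect_eq rangeI singletonD)
      then show "F n x \<bullet> vm \<mu> (f -` (F n -` {F n x})) = 0" by simp
    qed auto
    also have "\<dots> = vm_integral (push_vm f \<mu>) (F n)"
      unfolding vm_integral_simple_function[OF simple]
      by (simp add: vm_push[OF f simple_function_borelD(2)[OF simple]])
    finally show ?thesis by simp
  qed
  moreover have "(\<lambda>n. vm_integral \<mu> (\<lambda>x. F n (f x))) \<longlonglongrightarrow> vm_integral \<mu> (\<lambda>x. g (f x))"
    by (rule vm_integral_simple_limit[OF g Ff]) (use F in auto)
  ultimately show "vm_integral (push_vm f \<mu>) g = vm_integral \<mu> (\<lambda>x. g (f x))"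
    using vm_integral_simple_limit[OF gi F] LIMSEQ_unique by fastforce
qed

lemma measurable_fst_snd_borel:
  "(fst :: 'a::topological_space \<times> 'b::topological_space \<Rightarrow> 'a) \<in> borel_measurable borel"
  "(snd :: 'a \<times> 'b \<Rightarrow> 'b) \<in> borel_measurable borel"
  by (intro borel_measurable_continuous_onI continuous_intros)+

lemma marginal_eq_push:
  "marginal1 \<pi> = push_vm fst \<pi>" "marginal2 \<pi> = push_vm snd \<pi>"
  by (rule vm_eqI; simp add: vm_push measurable_fst_snd_borel marginal1.rep_eq marginal2.rep_eq
      fst_vimage_eq_Times snd_vimage_eq_Times)+

lemma push_push:
  assumes "f \<in> borel_measurable borel" "g \<in> borel_measurable borel"
  shows "push_vm g (push_vm f \<mu>) = push_vm (\<lambda>x. g (f x)) \<mu>"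
proof (rule vm_eqI)
  fix A :: "'c set" assume A: "A \<in> sets borel"
  have "g -` A \<in> sets borel" using measurable_sets[OF assms(2) A] by simp
  moreover have "(\<lambda>x. g (f x)) \<in> borel_measurable borel" using assms by (rule measurable_compose)
  ultimately show "vm (push_vm g (push_vm f \<mu>)) A = vm (push_vm (\<lambda>x. g (f x)) \<mu>) A"
    using A assms by (simp add: vm_push vimage_def)
qed

lemma push_ident: "push_vm (\<lambda>x. x) \<mu> = \<mu>"
  by (rule vm_eqI) (simp add: vm_push)

lemma vm_dirac: "A \<in> sets borel \<Longrightarrow> vm (dirac_vm x w) A = indicat_real A x *\<^sub>R w"
  by (simp add: dirac_vm.rep_eq)

lemma push_dirac:
  assumes "f \<in> borel_measurable borel"
  shows "push_vm f (dirac_vm x w) = dirac_vm (f x) w"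
proof (rule vm_eqI)
  fix A :: "'b set" assume A: "A \<in> sets borel"
  have "f -` A \<in> sets borel" using measurable_sets[OF assms A] by simp
  then show "vm (push_vm f (dirac_vm x w)) A = vm (dirac_vm (f x) w) A"
    using A assms by (simp add: vm_push vm_dirac indicator_def)
qed

text \<open>
  A Dirac measure is its own image under the constant map to its atom, so integrals with respect
  to it reduce to integrals of constants. The same device gives \<open>vm_integral_dirac\<close>.
\<close>

lemma nn_integral_dirac_le:
  assumes f: "f \<in> borel_measurable borel"
  shows "nn_integral (total_variation (dirac_vm x w)) f \<le> f x * ennreal (norm w)"
proof -
  have "variation (dirac_vm x w) UNIV \<le> ennreal (norm w)"
  proof (rule variation_leI)
    fix P :: "'a set set" assume P: "P \<in> borel_partitions UNIV"
    have "(\<Sum>E\<in>P. norm (vm (dirac_vm x w) E)) = (\<Sum>E\<in>P. indicat_real E x) * norm w"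
      unfolding sum_distrib_right
      using P by (intro sum.cong) (auto simp: vm_dirac borel_partitions_def)
    also have "(\<Sum>E\<in>P. indicat_real E x) = indicat_real (\<Union>E\<in>P. E) x"
      using P by (intro indicator_UN_disjoint[symmetric])
        (auto simp: borel_partitions_def disjoint_family_on_def disjoint_def)
    finally show "(\<Sum>E\<in>P. ennreal (norm (vm (dirac_vm x w) E))) \<le> ennreal (norm w)"
      using P by (simp add: borel_partitions_def)
  qed
  moreover have "nn_integral (total_variation (dirac_vm x w)) f
      \<le> (\<integral>\<^sup>+_. f x \<partial>total_variation (dirac_vm x w))"
    using nn_integral_push_le[of "\<lambda>_. x" f "dirac_vm x w"] f by (simp add: push_dirac)
  ultimately show ?thesis
    by (auto simp: emeasure_total_variation intro: order_trans[OF _ mult_left_mono])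
qed

lemma vm_integral_dirac:
  fixes u :: "'a::topological_space \<Rightarrow> real^'m"
  assumes u: "u \<in> borel_measurable borel"
  shows "integrable (total_variation (dirac_vm x w)) u"
    and "vm_integral (dirac_vm x w) u = u x \<bullet> w"
proof -
  interpret finite_measure "total_variation (dirac_vm x w)" by (rule finite_measure_total_variation)
  have "vm_integral (dirac_vm x w) (\<lambda>_. u x) = u x \<bullet> w"
    by (subst vm_integral_simple_function) (auto simp: vimage_def vm_dirac)
  then show "integrable (total_variation (dirac_vm x w)) u"
    and "vm_integral (dirac_vm x w) u = u x \<bullet> w"
    using integrable_push[of "\<lambda>_. x" u "dirac_vm x w"] vm_integral_push[of "\<lambda>_. x" u "dirac_vm x w"] u by (simp_all add: push_dirac)
qed

section \<open>The Wasserstein space\<close>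

definition transport_cost :: "('a::metric_space \<times> 'a, 'b::real_normed_vector) vmeasure \<Rightarrow> ennreal" where
  "transport_cost \<pi> = (\<integral>\<^sup>+p. ennreal (dist (fst p) (snd p)) \<partial>total_variation \<pi>)"

lemma wass_norm_altdef: "wass_norm \<mu> = enn2real (INF \<pi>\<in>couplings \<mu>. transport_cost \<pi>)"
  by (simp add: wass_norm_def transport_cost_def)

lemma wass_norm_nonneg: "0 \<le> wass_norm \<mu>"
  by (simp add: wass_norm_def)

lemma wass_norm_le:
  assumes "\<pi> \<in> couplings \<mu>" "transport_cost \<pi> \<le> ennreal c" "0 \<le> c"
  shows "wass_norm \<mu> \<le> c"
proof -
  have "(INF \<pi>\<in>couplings \<mu>. transport_cost \<pi>) \<le> ennreal c"
    using assms(1,2) by (rule INF_lower2)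
  then show ?thesis
    using assms(3) unfolding wass_norm_altdef by (simp add: enn2real_leI)
qed

lemma borel_measurable_dist_pair:
  "(\<lambda>p. dist (fst p) (snd p)) \<in> borel_measurable (borel :: ('a::metric_space \<times> 'a) measure)"
  by (intro borel_measurable_continuous_onI continuous_intros)

text \<open>
  The image of \<open>\<mu>\<close> under the pair couples \<open>f x\<close> with \<open>g x\<close>. With one of the maps the
  identity it estimates how far \<open>\<mu>\<close> is from its image under the other.
\<close>

lemma push_pair_coupling:
  fixes f g :: "'a::topological_space \<Rightarrow> 'c::{metric_space, second_countable_topology}"
  assumes [measurable]: "f \<in> borel_measurable borel" "g \<in> borel_measurable borel"
  shows "push_vm (\<lambda>x. (f x, g x)) \<mu> \<in> couplings (push_vm f \<mu> - push_vm g \<mu>)"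
    and "transport_cost (push_vm (\<lambda>x. (f x, g x)) \<mu>)
      \<le> (\<integral>\<^sup>+x. ennreal (dist (f x) (g x)) \<partial>total_variation \<mu>)"
proof -
  have fg: "(\<lambda>x. (f x, g x)) \<in> borel_measurable borel" by measurable
  show "push_vm (\<lambda>x. (f x, g x)) \<mu> \<in> couplings (push_vm f \<mu> - push_vm g \<mu>)"
    by (simp add: couplings_def marginal_eq_push push_push[OF fg measurable_fst_snd_borel(1)]
        push_push[OF fg measurable_fst_snd_borel(2)])
  show "transport_cost (push_vm (\<lambda>x. (f x, g x)) \<mu>)
      \<le> (\<integral>\<^sup>+x. ennreal (dist (f x) (g x)) \<partial>total_variation \<mu>)"
    unfolding transport_cost_def
    using nn_integral_push_le[OF fg, of "\<lambda>p. ennreal (dist (fst p) (snd p))" \<mu>] borel_measurable_dist_pair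
    by simp
qed

lemma borel_measurable_dist_const:
  "(\<lambda>x. dist x a) \<in> borel_measurable (borel :: 'a::metric_space measure)"
  by (intro borel_measurable_continuous_onI continuous_intros)

text \<open>
  Since the total variation is finite, integrability of the distance does not depend on the base
  point. This turns the existential quantifier in the definition into a condition that is visibly
  linear; \<open>undefined\<close> then serves as an arbitrary base point.
\<close>

lemma wass_space_iff:
  fixes \<mu> :: "('a::metric_space, real^'m) vmeasure"
  shows "\<mu> \<in> wass_space \<longleftrightarrow> vm \<mu> UNIV = 0 \<and> integrable (total_variation \<mu>) (\<lambda>x. dist x a)"
proof -
  interpret finite_measure "total_variation \<mu>" by (rule finite_measure_total_variation)
  have "integrable (total_variation \<mu>) (\<lambda>x. dist x b) \<longleftrightarrow>
      (\<integral>\<^sup>+x. ennreal (dist x b) \<partial>total_variation \<mu>) < \<infinity>" for b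
    by (simp add: integrable_iff_bounded borel_measurable_total_variation borel_measurable_dist_const)
  moreover have "integrable (total_variation \<mu>) (\<lambda>x. dist x a)"
    if b: "integrable (total_variation \<mu>) (\<lambda>x. dist x b)" for b
  proof (rule Bochner_Integration.integrable_bound)
    show "integrable (total_variation \<mu>) (\<lambda>x. dist x b + dist b a)" using b by simp
  qed (auto simp: borel_measurable_total_variation borel_measurable_dist_const dist_triangle)
  ultimately show ?thesis unfolding wass_space_def by blast
qed

lemma wass_space_add:
  fixes \<mu> \<nu> :: "('a::metric_space, real^'m) vmeasure"
  assumes "\<mu> \<in> wass_space" "\<nu> \<in> wass_space"
  shows "\<mu> + \<nu> \<in> wass_space"
  using assms unfolding wass_space_iff[of _ undefined]
  by (simp add: plus_vmeasure.rep_eq integrable_total_variation_add)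

lemma wass_space_scaleR:
  fixes \<mu> :: "('a::metric_space, real^'m) vmeasure"
  assumes "\<mu> \<in> wass_space"
  shows "c *\<^sub>R \<mu> \<in> wass_space"
  using assms unfolding wass_space_iff[of _ undefined]
  by (simp add: scaleR_vmeasure.rep_eq integrable_total_variation_scaleR)

lemma wass_space_diff:
  fixes \<mu> \<nu> :: "('a::metric_space, real^'m) vmeasure"
  assumes "\<mu> \<in> wass_space" "\<nu> \<in> wass_space"
  shows "\<mu> - \<nu> \<in> wass_space"
  using wass_space_add[OF assms(1) wass_space_scaleR[OF assms(2), of "-1"]] by simp

lemma dirac_diff_in_wass_space:
  fixes w :: "real^'m" and x y :: "'a::metric_space"
  shows "dirac_vm x w - dirac_vm y w \<in> wass_space"
proof -
  have int: "integrable (total_variation (dirac_vm z w)) (\<lambda>z. dist z y)" for z :: 'a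
  proof (rule integrable_total_variation_le[OF borel_measurable_dist_const])
    have "(\<integral>\<^sup>+a. ennreal (dist a y) \<partial>total_variation (dirac_vm z w)) \<le> ennreal (dist z y) * ennreal (norm w)"
      by (rule nn_integral_dirac_le) (use borel_measurable_dist_const in simp)
    also have "\<dots> < \<infinity>" by (simp add: ennreal_mult_less_top)
    finally show "(\<integral>\<^sup>+a. ennreal (norm (dist a y)) \<partial>total_variation (dirac_vm z w)) < \<infinity>" by simp
  qed
  have "dirac_vm x w - dirac_vm y w = dirac_vm x w + (-1) *\<^sub>R dirac_vm y w" by simp
  then have "integrable (total_variation (dirac_vm x w - dirac_vm y w)) (\<lambda>z. dist z y)"
    using integrable_total_variation_add[OF int integrable_total_variation_scaleR[OF int]] by metis
  then show ?thesis
    by (simp add: wass_space_iff[of _ y] minus_vmeasure.rep_eq vm_dirac)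
qed

lemma wass_norm_dirac_diff:
  fixes x y :: "'a::{metric_space, second_countable_topology}"
  shows "wass_norm (dirac_vm x w - dirac_vm y w) \<le> dist x y * norm w"
proof (rule wass_norm_le)
  show "dirac_vm (x, y) w \<in> couplings (dirac_vm x w - dirac_vm y w)"
    by (simp add: couplings_def marginal_eq_push push_dirac measurable_fst_snd_borel)
  show "transport_cost (dirac_vm (x, y) w) \<le> ennreal (dist x y * norm w)"
    unfolding transport_cost_def
    using nn_integral_dirac_le[of "\<lambda>p. ennreal (dist (fst p) (snd p))" "(x, y)" w] borel_measurable_dist_pair
    by (simp add: ennreal_mult)
qed simp

lemma lipschitz_on_imp_borel_measurable:
  "L-lipschitz_on UNIV u \<Longrightarrow> u \<in> borel_measurable borel"
  by (intro borel_measurable_continuous_onI lipschitz_on_continuous_on)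

lemma integrable_lipschitz:
  fixes \<mu> :: "('a::metric_space, real^'m) vmeasure"
    and u :: "'a \<Rightarrow> 'b::{banach, second_countable_topology}"
  assumes \<mu>: "\<mu> \<in> wass_space" and u: "L-lipschitz_on UNIV u"
  shows "integrable (total_variation \<mu>) u"
proof (rule Bochner_Integration.integrable_bound)
  interpret finite_measure "total_variation \<mu>" by (rule finite_measure_total_variation)
  show "integrable (total_variation \<mu>) (\<lambda>x. L * dist x undefined + norm (u undefined))"
    using \<mu> wass_space_iff[of \<mu> undefined] by simp
  show "u \<in> borel_measurable (total_variation \<mu>)"
    using lipschitz_on_imp_borel_measurable[OF u] by (simp add: borel_measurable_total_variation)
  have "norm (u x) \<le> L * dist x undefined + norm (u undefined)" for x
    using lipschitz_onD[OF u, of x undefined] norm_triangle_sub[of "u x" "u undefined"]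
    by (simp add: dist_norm)
  then show "AE x in total_variation \<mu>. norm (u x) \<le> norm (L * dist x undefined + norm (u undefined))"
    by (intro AE_I2) (simp add: order_trans[OF _ abs_ge_self])
qed

text \<open>
  Formally \<open>\<integral>\<langle>u, d\<mu>\<rangle> = \<integral>\<langle>u x - u y, d\<pi>\<rangle>\<close>, and the integrand on the right has
  norm at most \<open>L * dist x y\<close>. But the marginals of \<open>\<pi>\<close> need not have a first moment, so
  \<open>u\<close> need not be integrable for them. The nearest-point projections of \<open>u\<close> onto large balls
  are bounded, keep the Lipschitz constant because such projections are nonexpansive, and converge
  to \<open>u\<close> under the bound \<open>norm (u x)\<close>.
\<close>

lemma vm_integral_coupling_bound:
  fixes \<mu> :: "('a::{metric_space, second_countable_topology}, real^'m) vmeasure"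
  assumes \<mu>: "\<mu> \<in> wass_space" and u: "L-lipschitz_on UNIV u"
    and \<pi>: "\<pi> \<in> couplings \<mu>" and cost: "transport_cost \<pi> < \<infinity>"
  shows "\<bar>vm_integral \<mu> u\<bar> \<le> L * enn2real (transport_cost \<pi>)"
proof -
  interpret finite_measure "total_variation \<pi>" by (rule finite_measure_total_variation)
  have L: "0 \<le> L" using u by (rule lipschitz_on_nonneg)
  have um: "u \<in> borel_measurable borel" by (rule lipschitz_on_imp_borel_measurable[OF u])
  \<comment> \<open>\<open>U n\<close> is the truncation of \<open>u\<close> at norm \<open>n\<close>.\<close>
  define B where "B n = cball (0::real^'m) (real n)" for n
  have B: "convex (B n)" "closed (B n)" "B n \<noteq> {}" "0 \<in> B n" for n by (auto simp: B_def)
  define U where "U n x = closest_point (B n) (u x)" for n x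
  have Um: "U n \<in> borel_measurable borel" for n
    using um borel_measurable_continuous_onI[OF continuous_on_closest_point[OF B(1-3)]]
    unfolding U_def by (rule measurable_compose)
  have U_le: "norm (U n x) \<le> real n" for n x
    using closest_point_in_set[OF B(2,3), of n "u x"] by (simp add: U_def B_def)
  have U_diff: "norm (U n x - U n y) \<le> L * dist x y" for n x y
    using closest_point_lipschitz[OF B(1-3), of n "u x" "u y"] lipschitz_onD[OF u, of x y]
    by (simp add: U_def dist_norm)
  have U_norm: "norm (U n x) \<le> norm (u x)" for n x
    using closest_point_lipschitz[OF B(1-3), of n "u x" 0] closest_point_self[OF B(4)]
    by (simp add: U_def)
  have lim: "(\<lambda>n. U n x) \<longlonglongrightarrow> u x" for x
  proof (rule tendsto_eventually)
    obtain N where N: "norm (u x) \<le> real N" using real_arch_simple by blast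
    have "U n x = u x" if "n \<ge> N" for n
      using N that unfolding U_def B_def by (intro closest_point_self) simp
    then show "eventually (\<lambda>n. U n x = u x) sequentially"
      by (auto simp: eventually_sequentially)
  qed
  have dist_int: "integrable (total_variation \<pi>) (\<lambda>p. dist (fst p) (snd p))"
    using cost borel_measurable_dist_pair
    by (intro integrable_total_variation_le) (auto simp: transport_cost_def)
  have "\<bar>vm_integral \<mu> (U n)\<bar> \<le> L * enn2real (transport_cost \<pi>)" for n
  proof -
    have Up_m: "(\<lambda>p. U n (fst p)) \<in> borel_measurable borel" "(\<lambda>p. U n (snd p)) \<in> borel_measurable borel"
      by (rule measurable_compose[OF measurable_fst_snd_borel(1) Um],
          rule measurable_compose[OF measurable_fst_snd_borel(2) Um])
    have Up: "integrable (total_variation \<pi>) (\<lambda>p. U n (fst p))"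
      "integrable (total_variation \<pi>) (\<lambda>p. U n (snd p))"
      using Up_m U_le
      by (auto intro!: integrable_const_bound[where B = "real n"] simp: borel_measurable_total_variation)
    have "vm_integral \<mu> (U n) = vm_integral (push_vm fst \<pi> - push_vm snd \<pi>) (U n)"
      using \<pi> by (simp add: couplings_def marginal_eq_push)
    also have "\<dots> = vm_integral \<pi> (\<lambda>p. U n (fst p)) - vm_integral \<pi> (\<lambda>p. U n (snd p))"
      using integrable_push[OF measurable_fst_snd_borel(1) Um Up(1)]
        integrable_push[OF measurable_fst_snd_borel(2) Um Up(2)]
        vm_integral_push[OF measurable_fst_snd_borel(1) Um Up(1)]
        vm_integral_push[OF measurable_fst_snd_borel(2) Um Up(2)]
      by (simp add: vm_integral_measure_diff)
    also have "\<dots> = vm_integral \<pi> (\<lambda>p. U n (fst p) - U n (snd p))"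
      using Up by (intro vm_integral_diff[symmetric] vm_integrableI)
    also have "\<bar>\<dots>\<bar> \<le> (\<integral>p. norm (U n (fst p) - U n (snd p)) \<partial>total_variation \<pi>)"
      using Up by (intro vm_integral_bound) auto
    also have "\<dots> \<le> (\<integral>p. L * dist (fst p) (snd p) \<partial>total_variation \<pi>)"
      using Up dist_int U_diff by (intro integral_mono) auto
    also have "\<dots> = L * enn2real (transport_cost \<pi>)"
      using borel_measurable_integrable[OF dist_int]
      by (simp add: transport_cost_def integral_eq_nn_integral)
    finally show ?thesis .
  qed
  moreover have "(\<lambda>n. vm_integral \<mu> (U n)) \<longlonglongrightarrow> vm_integral \<mu> u"
    using integrable_lipschitz[OF \<mu> u] Um um lim U_norm
    by (intro vm_integral_dominated_convergence[where w = "\<lambda>x. norm (u x)"]) auto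
  ultimately show ?thesis
    by (intro LIMSEQ_le_const2[OF tendsto_rabs]) auto
qed

text \<open>
  Finiteness of the infimum, which is what makes \<open>enn2real\<close> harmless in the definition of the
  norm, comes from moving all mass to one point \<open>a\<close>: as \<open>\<mu>\<close> has total mass 0, nothing
  remains there.
\<close>

lemma wass_norm_approx:
  fixes \<mu> :: "('a::{metric_space, second_countable_topology}, real^'m) vmeasure"
  assumes \<mu>: "\<mu> \<in> wass_space" and e: "0 < e"
  obtains \<pi> where "\<pi> \<in> couplings \<mu>" "transport_cost \<pi> < \<infinity>"
    "enn2real (transport_cost \<pi>) < wass_norm \<mu> + e"
proof -
  define I where "I = (INF \<pi>\<in>couplings \<mu>. transport_cost \<pi>)"
  obtain a :: 'a where True by blast
  \<comment> \<open>the second marginal of the coupling that moves all mass to \<open>a\<close>\<close>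
  have zero: "push_vm (\<lambda>_. a) \<mu> = 0"
    using \<mu> by (intro vm_eqI) (auto simp: vm_push zero_vmeasure.rep_eq wass_space_def vimage_def)
  have "push_vm (\<lambda>x. (x, a)) \<mu> \<in> couplings \<mu>"
    using push_pair_coupling(1)[of "\<lambda>x. x" "\<lambda>_. a" \<mu>] by (simp add: push_ident zero)
  moreover have "transport_cost (push_vm (\<lambda>x. (x, a)) \<mu>) < \<infinity>"
    using push_pair_coupling(2)[of "\<lambda>x. x" "\<lambda>_. a" \<mu>] \<mu> wass_space_iff[of \<mu> a]
    by (auto simp: integrable_iff_bounded intro: le_less_trans)
  ultimately have fin: "I < \<infinity>" unfolding I_def by (auto intro: INF_lower le_less_trans)
  then have I: "I = ennreal (wass_norm \<mu>)" by (simp add: I_def wass_norm_altdef)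
  have "I < ennreal (wass_norm \<mu> + e)"
    using e wass_norm_nonneg[of \<mu>] by (simp add: I ennreal_less_iff)
  then obtain \<pi> where \<pi>: "\<pi> \<in> couplings \<mu>" "transport_cost \<pi> < ennreal (wass_norm \<mu> + e)"
    unfolding I_def INF_less_iff by blast
  show thesis
  proof (rule that[OF \<pi>(1)])
    show fin: "transport_cost \<pi> < \<infinity>" using \<pi>(2) by (rule less_trans) simp
    have "ennreal (enn2real (transport_cost \<pi>)) < ennreal (wass_norm \<mu> + e)"
      using \<pi>(2) fin by simp
    then show "enn2real (transport_cost \<pi>) < wass_norm \<mu> + e"
      by (simp add: ennreal_less_iff)
  qed
qed

lemma vm_integral_lipschitz_bound:
  fixes \<mu> :: "('a::{metric_space, second_countable_topology}, real^'m) vmeasure"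
  assumes \<mu>: "\<mu> \<in> wass_space" and u: "L-lipschitz_on UNIV u"
  shows "\<bar>vm_integral \<mu> u\<bar> \<le> L * wass_norm \<mu>"
proof -
  have L: "0 \<le> L" using u by (rule lipschitz_on_nonneg)
  have "\<bar>vm_integral \<mu> u\<bar> \<le> L * (wass_norm \<mu> + inverse (real (Suc n)))" for n
  proof -
    obtain \<pi> where \<pi>: "\<pi> \<in> couplings \<mu>" "transport_cost \<pi> < \<infinity>"
      "enn2real (transport_cost \<pi>) < wass_norm \<mu> + inverse (real (Suc n))"
      using wass_norm_approx[OF \<mu>, of "inverse (real (Suc n))"] by auto
    show ?thesis
      using vm_integral_coupling_bound[OF \<mu> u \<pi>(1,2)] mult_left_mono[OF less_imp_le[OF \<pi>(3)] L]
      by linarith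
  qed
  moreover have "(\<lambda>n. L * (wass_norm \<mu> + inverse (real (Suc n)))) \<longlonglongrightarrow> L * (wass_norm \<mu> + 0)"
    by (intro tendsto_intros LIMSEQ_inverse_real_of_nat)
  ultimately show ?thesis by (intro LIMSEQ_le_const) auto
qed

text \<open>
  The image of \<open>\<mu>\<close> under a map with finite range is a finite combination of Dirac measures; the
  subtracted terms at \<open>a\<close> add up to the total mass 0.
\<close>

lemma push_simple_eq_sum_dirac:
  fixes \<mu> :: "('a::topological_space, 'b::real_normed_vector) vmeasure"
    and F :: "'a \<Rightarrow> 'c::t1_space"
  assumes F: "simple_function borel F" "F \<in> borel_measurable borel" and \<mu>: "vm \<mu> UNIV = 0"
  shows "push_vm F \<mu> = (\<Sum>y\<in>range F. dirac_vm y (vm \<mu> (F -` {y})) - dirac_vm a (vm \<mu> (F -` {y})))"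
proof (rule vm_eqI)
  fix A :: "'c set" assume A: "A \<in> sets borel"
  have fin: "finite (range F)" and meas: "\<And>y. F -` {y} \<in> sets borel"
    using simple_function_borelD[OF F(1)] by auto
  have vm_sum: "vm (\<Sum>y\<in>I. G y) A = (\<Sum>y\<in>I. vm (G y) A)" for I and G :: "'c \<Rightarrow> ('c, 'b) vmeasure"
    by (induction I rule: infinite_finite_induct) (auto simp: zero_vmeasure.rep_eq plus_vmeasure.rep_eq)
  have UN: "vm \<mu> (\<Union>y\<in>J. F -` {y}) = (\<Sum>y\<in>J. vm \<mu> (F -` {y}))" if "J \<subseteq> range F" for J
    using finite_subset[OF that fin] meas by (intro vm_UN_finite) (auto simp: disjoint_family_on_def)
  have "(\<Union>y\<in>range F. F -` {y}) = UNIV" by auto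
  then have total: "(\<Sum>y\<in>range F. vm \<mu> (F -` {y})) = 0" using UN[of "range F"] \<mu> by simp
  have "F -` A = (\<Union>y\<in>range F \<inter> A. F -` {y})" by auto
  then have "vm (push_vm F \<mu>) A = (\<Sum>y\<in>range F \<inter> A. vm \<mu> (F -` {y}))"
    using UN[of "range F \<inter> A"] F(2) A by (simp add: vm_push)
  also have "\<dots> = (\<Sum>y\<in>range F. indicat_real A y *\<^sub>R vm \<mu> (F -` {y}))"
    using fin by (auto simp: sum.inter_restrict indicator_def intro!: sum.cong)
  also have "\<dots> = (\<Sum>y\<in>range F. vm (dirac_vm y (vm \<mu> (F -` {y})) - dirac_vm a (vm \<mu> (F -` {y}))) A)"
    using A total by (simp add: minus_vmeasure.rep_eq vm_dirac sum_subtractf flip: scaleR_sum_right)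
  finally show "vm (push_vm F \<mu>) A
      = vm (\<Sum>y\<in>range F. dirac_vm y (vm \<mu> (F -` {y})) - dirac_vm a (vm \<mu> (F -` {y}))) A"
    by (simp add: vm_sum)
qed

text \<open>
  Density of finitely supported measures. Separability provides simple maps \<open>F n\<close> that converge
  pointwise to the identity with \<open>dist (F n x) a \<le> 2 * dist x a\<close>. Moving the mass at \<open>x\<close> to
  \<open>F n x\<close> costs \<open>\<integral>dist (F n x) x d\<parallel>\<mu>\<parallel>\<close>, which tends to 0 by dominated convergence.
\<close>

lemma simple_approximation_in_wass_norm:
  fixes \<mu> :: "('a::{metric_space, second_countable_topology}, real^'m) vmeasure"
  assumes \<mu>: "\<mu> \<in> wass_space"
  obtains F :: "nat \<Rightarrow> 'a \<Rightarrow> 'a" where "\<And>n. simple_function borel (F n)"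
    "\<And>n. F n \<in> borel_measurable borel" "\<And>n. push_vm (F n) \<mu> \<in> wass_space"
    "(\<lambda>n. wass_norm (push_vm (F n) \<mu> - \<mu>)) \<longlonglongrightarrow> 0"
proof -
  obtain a :: 'a where True by blast
  obtain F :: "nat \<Rightarrow> 'a \<Rightarrow> 'a" where F: "\<And>n. simple_function borel (F n)"
    "\<And>n. F n \<in> borel_measurable borel" "\<And>x. (\<lambda>n. F n x) \<longlonglongrightarrow> x"
    "\<And>n x. dist (F n x) a \<le> 2 * dist x a"
    using simple_function_approximation[of "\<lambda>x. x" a] by auto
  have dist_m: "(\<lambda>x. dist (F n x) x) \<in> borel_measurable borel" for n
    using F(2)[of n] by measurable
  have dist_le: "dist (F n x) x \<le> 3 * dist x a" for n x
    using dist_triangle2[of "F n x" x a] F(4)[of n x] by linarith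
  have \<mu>a: "integrable (total_variation \<mu>) (\<lambda>x. dist x a)" and zero: "vm \<mu> UNIV = 0"
    using \<mu> wass_space_iff[of \<mu> a] by auto
  have dist_int: "integrable (total_variation \<mu>) (\<lambda>x. dist (F n x) x)" for n
  proof (rule Bochner_Integration.integrable_bound)
    show "integrable (total_variation \<mu>) (\<lambda>x. 3 * dist x a)" using \<mu>a by simp
  qed (use dist_m dist_le in \<open>simp_all add: borel_measurable_total_variation\<close>)
  have lim: "(\<lambda>n. \<integral>x. dist (F n x) x \<partial>total_variation \<mu>) \<longlonglongrightarrow> (\<integral>x. 0 \<partial>total_variation \<mu>)"
  proof (rule integral_dominated_convergence)
    show "integrable (total_variation \<mu>) (\<lambda>x. 3 * dist x a)" using \<mu>a by simp
    show "AE x in total_variation \<mu>. (\<lambda>n. dist (F n x) x) \<longlonglongrightarrow> 0"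
      using F(3) by (simp add: tendsto_dist_iff[symmetric])
  qed (use dist_m dist_le in \<open>simp_all add: borel_measurable_total_variation\<close>)
  have push_in: "push_vm (F n) \<mu> \<in> wass_space" for n
  proof -
    have "integrable (total_variation \<mu>) (\<lambda>x. dist (F n x) a)"
    proof (rule Bochner_Integration.integrable_bound)
      show "integrable (total_variation \<mu>) (\<lambda>x. 2 * dist x a)" using \<mu>a by simp
    qed (use F(4)[of n] measurable_compose[OF F(2) borel_measurable_dist_const] in
        \<open>simp_all add: borel_measurable_total_variation\<close>)
    then have "integrable (total_variation (push_vm (F n) \<mu>)) (\<lambda>x. dist x a)"
      by (rule integrable_push[OF F(2) borel_measurable_dist_const])
    then show ?thesis using zero F(2) by (simp add: wass_space_iff[of _ a] vm_push)
  qed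
  have "wass_norm (push_vm (F n) \<mu> - \<mu>) \<le> (\<integral>x. dist (F n x) x \<partial>total_variation \<mu>)" for n
  proof (rule wass_norm_le)
    show "push_vm (\<lambda>x. (F n x, x)) \<mu> \<in> couplings (push_vm (F n) \<mu> - \<mu>)"
      using push_pair_coupling(1)[OF F(2), of "\<lambda>x. x" n \<mu>] by (simp add: push_ident)
    show "transport_cost (push_vm (\<lambda>x. (F n x, x)) \<mu>) \<le> ennreal (\<integral>x. dist (F n x) x \<partial>total_variation \<mu>)"
      using push_pair_coupling(2)[OF F(2), of "\<lambda>x. x" n \<mu>] dist_int[of n]
      by (simp add: nn_integral_eq_integral)
  qed simp
  note le = this
  have "(\<lambda>n. wass_norm (push_vm (F n) \<mu> - \<mu>)) \<longlonglongrightarrow> 0"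
  proof (rule real_tendsto_sandwich[where f = "\<lambda>_. 0"])
    show "(\<lambda>n. \<integral>x. dist (F n x) x \<partial>total_variation \<mu>) \<longlonglongrightarrow> 0" using lim by simp
    show "\<forall>\<^sub>F n in sequentially. wass_norm (push_vm (F n) \<mu> - \<mu>) \<le> (\<integral>x. dist (F n x) x \<partial>total_variation \<mu>)"
      by (rule always_eventually) (rule allI, rule le)
  qed (simp_all add: wass_norm_nonneg)
  then show thesis by (rule that[OF F(1,2) push_in])
qed

section \<open>Duality\<close>

lemma lip_norm_bounds:
  fixes u :: "'a::metric_space \<Rightarrow> 'b::real_normed_vector"
  assumes u: "K-lipschitz_on UNIV u"
  shows "lip_norm u \<le> K" and "(lip_norm u)-lipschitz_on UNIV u"
proof -
  let ?Q = "insert 0 {norm (u x - u y) / dist x y | x y. x \<noteq> y}"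
  have K: "0 \<le> K" using u by (rule lipschitz_on_nonneg)
  have le: "q \<le> K" if "q \<in> ?Q" for q
    using that K lipschitz_onD[OF u] by (auto simp: dist_norm pos_divide_le_eq)
  then show "lip_norm u \<le> K" unfolding lip_norm_def by (intro cSup_least) auto
  have bdd: "bdd_above ?Q" using le by (intro bdd_aboveI)
  have up: "q \<le> lip_norm u" if "q \<in> ?Q" for q
    unfolding lip_norm_def using that bdd by (rule cSup_upper)
  show "(lip_norm u)-lipschitz_on UNIV u"
  proof (rule lipschitz_onI)
    show "0 \<le> lip_norm u" by (rule up) simp
    show "dist (u x) (u y) \<le> lip_norm u * dist x y" for x y
    proof (cases "x = y")
      case False
      then have "norm (u x - u y) / dist x y \<le> lip_norm u" by (intro up) auto
      then show ?thesis using False by (simp add: dist_norm pos_divide_le_eq)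
    qed simp
  qed
qed

lemma lip_spaceD:
  assumes "u \<in> lip_space x0"
  shows "u x0 = 0" and "(lip_norm u)-lipschitz_on UNIV u"
  using assms lip_norm_bounds(2) by (auto simp: lip_space_def)

lemma wass_dualD:
  assumes "\<phi> \<in> wass_dual"
  shows "\<mu> \<notin> wass_space \<Longrightarrow> \<phi> \<mu> = 0"
    and "\<mu> \<in> wass_space \<Longrightarrow> \<nu> \<in> wass_space \<Longrightarrow> \<phi> (\<mu> + \<nu>) = \<phi> \<mu> + \<phi> \<nu>"
    and "\<mu> \<in> wass_space \<Longrightarrow> \<phi> (c *\<^sub>R \<mu>) = c * \<phi> \<mu>"
    and "\<mu> \<in> wass_space \<Longrightarrow> 0 < \<epsilon> \<Longrightarrow>
      \<exists>\<delta>>0. \<forall>\<nu>\<in>wass_space. wass_norm (\<nu> - \<mu>) < \<delta> \<longrightarrow> \<bar>\<phi> \<nu> - \<phi> \<mu>\<bar> < \<epsilon>"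
  using assms unfolding wass_dual_def by blast+

lemma T_op_bound:
  fixes u :: "'a::{metric_space, second_countable_topology} \<Rightarrow> real^'m"
  assumes "u \<in> lip_space x0" "\<mu> \<in> wass_space"
  shows "\<bar>T_op u \<mu>\<bar> \<le> lip_norm u * wass_norm \<mu>"
  using vm_integral_lipschitz_bound[OF assms(2) lip_spaceD(2)[OF assms(1)]] assms(2)
  by (simp add: T_op_def)

lemma T_op_measure_linear:
  fixes u :: "'a::{metric_space, second_countable_topology} \<Rightarrow> real^'m"
  assumes u: "u \<in> lip_space x0" and \<mu>: "\<mu> \<in> wass_space"
  shows "\<nu> \<in> wass_space \<Longrightarrow> T_op u (\<mu> + \<nu>) = T_op u \<mu> + T_op u \<nu>"
    and "T_op u (c *\<^sub>R \<mu>) = c * T_op u \<mu>"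
proof -
  have int: "integrable (total_variation \<rho>) u" if "\<rho> \<in> wass_space" for \<rho> :: "('a, real^'m) vmeasure"
    using that lip_spaceD(2)[OF u] by (rule integrable_lipschitz)
  show "T_op u (\<mu> + \<nu>) = T_op u \<mu> + T_op u \<nu>" if "\<nu> \<in> wass_space"
    using \<mu> that by (simp add: T_op_def wass_space_add vm_integral_measure_add int)
  show "T_op u (c *\<^sub>R \<mu>) = c * T_op u \<mu>"
    using \<mu> by (simp add: T_op_def wass_space_scaleR vm_integral_measure_scaleR int)
qed

lemma T_op_in_wass_dual:
  fixes u :: "'a::{metric_space, second_countable_topology} \<Rightarrow> real^'m"
  assumes u: "u \<in> lip_space x0"
  shows "T_op u \<in> wass_dual"
proof -
  have "\<exists>\<delta>>0. \<forall>\<nu>\<in>wass_space. wass_norm (\<nu> - \<mu>) < \<delta> \<longrightarrow> \<bar>T_op u \<nu> - T_op u \<mu>\<bar> < \<epsilon>"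
    if \<mu>: "\<mu> \<in> wass_space" and e: "0 < \<epsilon>" for \<mu> and \<epsilon> :: real
  \<comment> \<open>the summand 1 covers the case \<open>lip_norm u = 0\<close>\<close>
  proof (intro exI[of _ "\<epsilon> / (lip_norm u + 1)"] conjI ballI impI)
    have L: "0 \<le> lip_norm u" using lip_spaceD(2)[OF u] by (rule lipschitz_on_nonneg)
    then show "0 < \<epsilon> / (lip_norm u + 1)" using e by simp
    fix \<nu> :: "('a, real^'m) vmeasure"
    assume \<nu>: "\<nu> \<in> wass_space" and small: "wass_norm (\<nu> - \<mu>) < \<epsilon> / (lip_norm u + 1)"
    have diff: "\<nu> - \<mu> \<in> wass_space" using \<nu> \<mu> by (rule wass_space_diff)
    have "T_op u \<nu> = T_op u (\<nu> - \<mu>) + T_op u \<mu>"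
      using T_op_measure_linear(1)[OF u diff \<mu>] by simp
    then have "\<bar>T_op u \<nu> - T_op u \<mu>\<bar> \<le> lip_norm u * wass_norm (\<nu> - \<mu>)"
      using T_op_bound[OF u diff] by simp
    also have "\<dots> \<le> (lip_norm u + 1) * wass_norm (\<nu> - \<mu>)"
      by (intro mult_right_mono) (simp_all add: wass_norm_nonneg)
    also have "\<dots> < \<epsilon>" using small L by (simp add: pos_less_divide_eq mult.commute)
    finally show "\<bar>T_op u \<nu> - T_op u \<mu>\<bar> < \<epsilon>" .
  qed
  then show ?thesis
    using T_op_measure_linear[OF u] by (auto simp: wass_dual_def T_op_def[of u])
qed

lemma T_op_dirac_diff:
  fixes u :: "'a::{metric_space, second_countable_topology} \<Rightarrow> real^'m"
  assumes u: "u \<in> lip_space x0"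
  shows "T_op u (dirac_vm x w - dirac_vm y w) = (u x - u y) \<bullet> w"
  using vm_integral_dirac[OF lipschitz_on_imp_borel_measurable[OF lip_spaceD(2)[OF u]]]
  by (simp add: T_op_def dirac_diff_in_wass_space vm_integral_measure_diff inner_diff_left)

lemma S_op_eqI:
  assumes "\<And>w. v \<bullet> w = \<phi> (dirac_vm x w - dirac_vm x0 w)"
  shows "S_op x0 \<phi> x = v"
  unfolding S_op_def
proof (rule the_equality)
  show "v' = v" if "\<forall>w. v' \<bullet> w = \<phi> (dirac_vm x w - dirac_vm x0 w)" for v'
    using that assms by (subst vector_eq_rdot[symmetric]) simp
qed (use assms in simp)

text \<open>
  The description in the definition of \<open>S_op\<close> is met because
  \<open>w \<mapsto> \<phi> ((\<delta>\<^sub>x - \<delta>\<^sub>x\<^sub>0) w)\<close> is linear, hence represented by a unique vector.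
\<close>

lemma S_op_inner:
  fixes \<phi> :: "('a::metric_space, real^'m) vmeasure \<Rightarrow> real"
  assumes \<phi>: "\<phi> \<in> wass_dual"
  shows "S_op x0 \<phi> x \<bullet> w = \<phi> (dirac_vm x w - dirac_vm x0 w)"
proof -
  define f where "f w = \<phi> (dirac_vm x w - dirac_vm x0 w)" for w
  have "linear f"
  proof (rule linearI)
    fix v w :: "real^'m" and c :: real
    have "dirac_vm x (v + w) - dirac_vm x0 (v + w)
        = (dirac_vm x v - dirac_vm x0 v) + (dirac_vm x w - dirac_vm x0 w)"
      by (rule vm_eqI) (simp add: vm_dirac minus_vmeasure.rep_eq plus_vmeasure.rep_eq algebra_simps)
    then show "f (v + w) = f v + f w"
      by (simp add: f_def wass_dualD(2)[OF \<phi>] dirac_diff_in_wass_space)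
    have "dirac_vm x (c *\<^sub>R v) - dirac_vm x0 (c *\<^sub>R v) = c *\<^sub>R (dirac_vm x v - dirac_vm x0 v)"
      by (rule vm_eqI) (simp add: vm_dirac minus_vmeasure.rep_eq scaleR_vmeasure.rep_eq algebra_simps)
    then show "f (c *\<^sub>R v) = c *\<^sub>R f v"
      by (simp add: f_def wass_dualD(3)[OF \<phi>] dirac_diff_in_wass_space)
  qed
  then have "adjoint f 1 \<bullet> w = f w" for w
    using adjoint_works[of f w 1] by (simp add: inner_commute)
  then have "S_op x0 \<phi> x = adjoint f 1" by (intro S_op_eqI) (simp add: f_def)
  then show ?thesis using \<open>adjoint f 1 \<bullet> w = f w\<close> by (simp add: f_def)
qed

text \<open>
  Continuity at 0 gives \<open>\<delta>\<close> such that \<open>\<phi>\<close> is smaller than 1 on the ball of radius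
  \<open>\<delta>\<close>. Testing with \<open>(\<delta>\<^sub>x - \<delta>\<^sub>y) w\<close>, where \<open>w\<close> is the multiple of
  \<open>S \<phi> x - S \<phi> y\<close> that makes the norm at most \<open>\<delta> / 2\<close>, bounds the difference quotients by
  \<open>2 / \<delta>\<close>.
\<close>

lemma S_op_in_lip_space:
  fixes \<phi> :: "('a::{metric_space, second_countable_topology}, real^'m) vmeasure \<Rightarrow> real"
  assumes \<phi>: "\<phi> \<in> wass_dual"
  shows "S_op x0 \<phi> \<in> lip_space x0"
proof -
  have zero_in: "0 \<in> (wass_space :: ('a, real^'m) vmeasure set)"
    using dirac_diff_in_wass_space[of undefined "0::real^'m" undefined] by simp
  have zero: "\<phi> 0 = 0" using wass_dualD(3)[OF \<phi> zero_in, of 0] by simp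
  obtain \<delta> where \<delta>: "\<delta> > 0" and small: "\<And>\<nu>. \<nu> \<in> wass_space \<Longrightarrow> wass_norm \<nu> < \<delta> \<Longrightarrow> \<bar>\<phi> \<nu>\<bar> < 1"
    using wass_dualD(4)[OF \<phi> zero_in, of 1] zero by auto
  let ?S = "S_op x0 \<phi>"
  have diff: "(?S x - ?S y) \<bullet> w = \<phi> (dirac_vm x w - dirac_vm y w)" for x y w
  proof -
    have "dirac_vm x w - dirac_vm x0 w = (dirac_vm x w - dirac_vm y w) + (dirac_vm y w - dirac_vm x0 w)"
      by simp
    then have "\<phi> (dirac_vm x w - dirac_vm x0 w)
        = \<phi> (dirac_vm x w - dirac_vm y w) + \<phi> (dirac_vm y w - dirac_vm x0 w)"
      using wass_dualD(2)[OF \<phi> dirac_diff_in_wass_space dirac_diff_in_wass_space] by metis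
    then show ?thesis by (simp only: S_op_inner[OF \<phi>] inner_diff_left)
  qed
  have "(2 / \<delta>)-lipschitz_on UNIV ?S"
  proof (rule lipschitz_onI)
    fix x y
    show "dist (?S x) (?S y) \<le> 2 / \<delta> * dist x y"
    proof (cases "?S x = ?S y")
      case False
      define v where "v = ?S x - ?S y"
      have v: "norm v > 0" and xy: "dist x y > 0" using False by (auto simp: v_def)
      \<comment> \<open>chosen so that \<open>dist x y * norm (t *\<^sub>R v) = \<delta> / 2\<close>\<close>
      define t where "t = \<delta> / (2 * dist x y * norm v)"
      have t: "t > 0" using v xy \<delta> by (simp add: t_def)
      have "wass_norm (dirac_vm x (t *\<^sub>R v) - dirac_vm y (t *\<^sub>R v)) \<le> dist x y * norm (t *\<^sub>R v)"
        by (rule wass_norm_dirac_diff)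
      also have "\<dots> = \<delta> / 2" using t v xy \<delta> by (simp add: t_def)
      also have "\<dots> < \<delta>" using \<delta> by simp
      finally have "\<bar>v \<bullet> (t *\<^sub>R v)\<bar> < 1"
        using small[OF dirac_diff_in_wass_space] diff[of x y "t *\<^sub>R v"] by (simp add: v_def)
      moreover have "v \<bullet> (t *\<^sub>R v) = \<delta> * norm v / (2 * dist x y)"
        using v xy by (simp add: t_def dot_square_norm power2_eq_square)
      ultimately have "\<delta> * norm v < 2 * dist x y" using \<delta> v xy by (simp add: field_simps)
      then show ?thesis using \<delta> by (simp add: v_def dist_norm field_simps)
    qed (use \<delta> in simp)
  qed (use \<delta> in simp)
  moreover have "?S x0 = 0" by (rule S_op_eqI) (simp add: zero)
  ultimately show ?thesis by (auto simp: lip_space_def)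
qed

text \<open>
  Both functionals are continuous and linear, and the Dirac differences at a fixed base point span
  a dense subspace.
\<close>

lemma wass_dual_eqI:
  fixes \<phi> \<psi> :: "('a::{metric_space, second_countable_topology}, real^'m) vmeasure \<Rightarrow> real"
  assumes \<phi>: "\<phi> \<in> wass_dual" and \<psi>: "\<psi> \<in> wass_dual"
    and dirac: "\<And>x w. \<phi> (dirac_vm x w - dirac_vm x0 w) = \<psi> (dirac_vm x w - dirac_vm x0 w)"
  shows "\<phi> = \<psi>"
proof
  fix \<mu>
  show "\<phi> \<mu> = \<psi> \<mu>"
  proof (cases "\<mu> \<in> wass_space")
    case True
    obtain F where F: "\<And>n. simple_function borel (F n)" "\<And>n. F n \<in> borel_measurable borel"
      and push: "\<And>n. push_vm (F n) \<mu> \<in> wass_space"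
      and lim: "(\<lambda>n. wass_norm (push_vm (F n) \<mu> - \<mu>)) \<longlonglongrightarrow> 0"
      using simple_approximation_in_wass_norm[OF True] by metis
    have sum: "(\<Sum>i\<in>I. \<nu> i) \<in> wass_space \<and> \<rho> (\<Sum>i\<in>I. \<nu> i) = (\<Sum>i\<in>I. \<rho> (\<nu> i))"
      if "\<rho> \<in> wass_dual" "\<And>i. \<nu> i \<in> wass_space" "finite I"
      for \<rho> and \<nu> :: "'a \<Rightarrow> ('a, real^'m) vmeasure" and I
      using that(3)
    proof (induction I)
      case empty
      have "0 *\<^sub>R \<nu> undefined \<in> wass_space" by (intro wass_space_scaleR that(2))
      then show ?case using wass_dualD(3)[OF that(1,2), of 0] by simp
    next
      case (insert i I)
      then show ?case using that(2)[of i] wass_dualD(2)[OF that(1), of "\<nu> i" "sum \<nu> I"]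
        by (simp add: wass_space_add)
    qed
    have eq: "\<phi> (push_vm (F n) \<mu>) = \<psi> (push_vm (F n) \<mu>)" for n
    proof -
      have "vm \<mu> UNIV = 0" using True by (simp add: wass_space_def)
      note rep = push_simple_eq_sum_dirac[OF F this, of n x0]
      let ?d = "\<lambda>y. dirac_vm y (vm \<mu> (F n -` {y})) - dirac_vm x0 (vm \<mu> (F n -` {y}))"
      note fin = simple_function_borelD(1)[OF F(1), of n]
      have "\<phi> (push_vm (F n) \<mu>) = (\<Sum>y\<in>range (F n). \<phi> (?d y))"
        unfolding rep using sum[OF \<phi> _ fin, of ?d] dirac_diff_in_wass_space by blast
      also have "\<dots> = (\<Sum>y\<in>range (F n). \<psi> (?d y))" by (simp only: dirac)
      also have "\<dots> = \<psi> (push_vm (F n) \<mu>)"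
        unfolding rep using sum[OF \<psi> _ fin, of ?d] dirac_diff_in_wass_space by metis
      finally show ?thesis .
    qed
    have conv: "(\<lambda>n. \<rho> (push_vm (F n) \<mu>)) \<longlonglongrightarrow> \<rho> \<mu>" if \<rho>: "\<rho> \<in> wass_dual" for \<rho>
    proof (rule tendstoI)
      fix e :: real assume "0 < e"
      then obtain \<delta> where \<delta>: "\<delta> > 0"
        and cont: "\<forall>\<nu>\<in>wass_space. wass_norm (\<nu> - \<mu>) < \<delta> \<longrightarrow> \<bar>\<rho> \<nu> - \<rho> \<mu>\<bar> < e"
        using wass_dualD(4)[OF \<rho> True] by blast
      show "\<forall>\<^sub>F n in sequentially. dist (\<rho> (push_vm (F n) \<mu>)) (\<rho> \<mu>) < e"
        using order_tendstoD(2)[OF lim \<delta>]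
        by eventually_elim (use cont push in \<open>simp add: dist_real_def\<close>)
    qed
    show ?thesis
      using conv[OF \<phi>] conv[OF \<psi>] unfolding eq by (rule LIMSEQ_unique)
  qed (simp add: wass_dualD(1)[OF \<phi>] wass_dualD(1)[OF \<psi>])
qed

text \<open>
  The bound \<open>T_op_bound\<close> gives one inequality. The other follows from testing with
  \<open>(\<delta>\<^sub>x - \<delta>\<^sub>y) w\<close>, where \<open>w\<close> has the direction of \<open>u x - u y\<close> and length
  \<open>1 / dist x y\<close>: this element of the unit ball gives the difference quotient of \<open>u\<close>.
\<close>

lemma wass_dual_norm_T_op:
  fixes u :: "'a::{metric_space, second_countable_topology} \<Rightarrow> real^'m"
  assumes u: "u \<in> lip_space x0"
  shows "wass_dual_norm (T_op u) = lip_norm u"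
proof (rule antisym)
  let ?B = "{\<mu> \<in> wass_space. wass_norm \<mu> \<le> 1} :: ('a, real^'m) vmeasure set"
  have L: "0 \<le> lip_norm u" using lip_spaceD(2)[OF u] by (rule lipschitz_on_nonneg)
  have le: "\<bar>T_op u \<mu>\<bar> \<le> lip_norm u" if "\<mu> \<in> ?B" for \<mu>
    using T_op_bound[OF u, of \<mu>] mult_left_mono[of "wass_norm \<mu>" 1 "lip_norm u"] that L by simp
  have zero: "dirac_vm x0 0 - dirac_vm x0 0 \<in> ?B"
    using dirac_diff_in_wass_space[of x0 "0::real^'m" x0] wass_norm_dirac_diff[of x0 "0::real^'m" x0]
    by simp
  then have ne: "?B \<noteq> {}" by blast
  then show "wass_dual_norm (T_op u) \<le> lip_norm u"
    unfolding wass_dual_norm_def using le by (rule cSUP_least)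
  have bdd: "bdd_above ((\<lambda>\<mu>. \<bar>T_op u \<mu>\<bar>) ` ?B)" using le by (rule bdd_aboveI2)
  have up: "\<bar>T_op u \<mu>\<bar> \<le> wass_dual_norm (T_op u)" if "\<mu> \<in> ?B" for \<mu>
    unfolding wass_dual_norm_def using bdd that by (rule cSUP_upper2) simp
  have nonneg: "0 \<le> wass_dual_norm (T_op u)" using up[OF zero] by simp
  have "(wass_dual_norm (T_op u))-lipschitz_on UNIV u"
  proof (rule lipschitz_onI[OF _ nonneg])
    fix x y
    show "dist (u x) (u y) \<le> wass_dual_norm (T_op u) * dist x y"
    proof (cases "u x = u y")
      case False
      define v where "v = u x - u y"
      have v: "norm v > 0" and xy: "dist x y > 0" using False by (auto simp: v_def)
      define w where "w = (1 / (dist x y * norm v)) *\<^sub>R v"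
      have "dist x y * norm w = 1" using v xy by (simp add: w_def)
      then have "dirac_vm x w - dirac_vm y w \<in> ?B"
        using wass_norm_dirac_diff[of x w y] by (simp add: dirac_diff_in_wass_space)
      then have "v \<bullet> w \<le> wass_dual_norm (T_op u)"
        using up[of "dirac_vm x w - dirac_vm y w"] unfolding T_op_dirac_diff[OF u] v_def by linarith
      moreover have "v \<bullet> w = norm v / dist x y"
        using v by (simp add: w_def dot_square_norm power2_eq_square)
      ultimately show ?thesis using xy by (simp add: v_def dist_norm pos_divide_le_eq)
    qed (use nonneg in simp)
  qed
  then show "lip_norm u \<le> wass_dual_norm (T_op u)" by (rule lip_norm_bounds(1))
qed

theorem theorem1:
  fixes x0 :: "'a::{metric_space, second_countable_topology}"
    and L :: "('a \<Rightarrow> real^'m) set"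
    and W :: "('a, real^'m) vmeasure set"
    and W_dual :: "(('a, real^'m) vmeasure \<Rightarrow> real) set"
  assumes polish: "completely_metrizable_space (euclidean :: 'a topology)"
  defines "L \<equiv> lip_space x0" and "W \<equiv> wass_space" and "W_dual \<equiv> wass_dual"
  shows
    "(\<forall>u\<in>L. \<forall>\<mu>\<in>W. vm_integrable \<mu> u \<and> T_op u \<mu> = vm_integral \<mu> u) \<and>
     (\<forall>x w. dirac_vm x w - dirac_vm x0 w \<in> W) \<and>
     (\<forall>\<phi>\<in>W_dual. \<forall>x w. S_op x0 \<phi> x \<bullet> w = \<phi> (dirac_vm x w - dirac_vm x0 w)) \<and>
     (\<forall>u\<in>L. T_op u \<in> W_dual) \<and>
     (\<forall>\<phi>\<in>W_dual. S_op x0 \<phi> \<in> L) \<and>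
     (\<forall>u\<in>L. S_op x0 (T_op u) = u) \<and>
     (\<forall>\<phi>\<in>W_dual. T_op (S_op x0 \<phi>) = \<phi>) \<and>
     (\<forall>u\<in>L. \<forall>v\<in>L. T_op (\<lambda>x. u x + v x) = (\<lambda>\<mu>. T_op u \<mu> + T_op v \<mu>)) \<and>
     (\<forall>c. \<forall>u\<in>L. T_op (\<lambda>x. c *\<^sub>R u x) = (\<lambda>\<mu>. c * T_op u \<mu>)) \<and>
     (\<forall>\<psi>\<in>W_dual. \<forall>\<phi>\<in>W_dual. S_op x0 (\<lambda>\<mu>. \<psi> \<mu> + \<phi> \<mu>) = (\<lambda>x. S_op x0 \<psi> x + S_op x0 \<phi> x)) \<and>
     (\<forall>c. \<forall>\<phi>\<in>W_dual. S_op x0 (\<lambda>\<mu>. c * \<phi> \<mu>) = (\<lambda>x. c *\<^sub>R S_op x0 \<phi> x)) \<and>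
     (\<forall>u\<in>L. wass_dual_norm (T_op u) = lip_norm u) \<and>
     (\<forall>\<phi>\<in>W_dual. lip_norm (S_op x0 \<phi>) = wass_dual_norm \<phi>)"
  unfolding L_def W_def W_dual_def
proof (intro conjI ballI allI)
  fix u v :: "'a \<Rightarrow> real^'m" and \<mu> :: "('a, real^'m) vmeasure" and c :: real
  assume u: "u \<in> lip_space x0"
  have integrable: "vm_integrable \<mu> u" if "\<mu> \<in> wass_space" "u \<in> lip_space x0"
    for \<mu> and u :: "'a \<Rightarrow> real^'m"
    using that lip_spaceD(2) by (blast intro: vm_integrableI integrable_lipschitz)
  show "vm_integrable \<mu> u" if "\<mu> \<in> wass_space" using that u by (rule integrable)
  show "T_op u \<mu> = vm_integral \<mu> u" if "\<mu> \<in> wass_space" using that by (simp add: T_op_def)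
  show "T_op u \<in> wass_dual" using u by (rule T_op_in_wass_dual)
  show "S_op x0 (T_op u) = u"
    by (rule ext, rule S_op_eqI) (simp add: T_op_dirac_diff[OF u] lip_spaceD(1)[OF u])
  show "T_op (\<lambda>x. u x + v x) = (\<lambda>\<mu>. T_op u \<mu> + T_op v \<mu>)" if "v \<in> lip_space x0"
    using integrable[OF _ u] integrable[OF _ that] by (auto simp: T_op_def vm_integral_add)
  show "T_op (\<lambda>x. c *\<^sub>R u x) = (\<lambda>\<mu>. c * T_op u \<mu>)"
    by (auto simp: T_op_def vm_integral_scaleR)
  show "wass_dual_norm (T_op u) = lip_norm u" using u by (rule wass_dual_norm_T_op)
next
  fix \<phi> \<psi> :: "('a, real^'m) vmeasure \<Rightarrow> real" and c :: real
  assume \<phi>: "\<phi> \<in> wass_dual"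
  note S = S_op_in_lip_space[OF \<phi>, of x0]
  show "S_op x0 \<phi> x \<bullet> w = \<phi> (dirac_vm x w - dirac_vm x0 w)" for x w
    using \<phi> by (rule S_op_inner)
  show "S_op x0 \<phi> \<in> lip_space x0" by (rule S)
  show TS: "T_op (S_op x0 \<phi>) = \<phi>"
    by (rule wass_dual_eqI[OF T_op_in_wass_dual[OF S] \<phi>, of x0])
      (simp add: T_op_dirac_diff[OF S] lip_spaceD(1)[OF S] S_op_inner[OF \<phi>])
  show "lip_norm (S_op x0 \<phi>) = wass_dual_norm \<phi>"
    using wass_dual_norm_T_op[OF S] by (simp add: TS)
  show "S_op x0 (\<lambda>\<mu>. c * \<phi> \<mu>) = (\<lambda>x. c *\<^sub>R S_op x0 \<phi> x)"
    by (rule ext, rule S_op_eqI) (simp add: S_op_inner[OF \<phi>])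
next
  fix \<phi> \<psi> :: "('a, real^'m) vmeasure \<Rightarrow> real"
  assume \<psi>: "\<psi> \<in> wass_dual" and \<phi>: "\<phi> \<in> wass_dual"
  show "S_op x0 (\<lambda>\<mu>. \<psi> \<mu> + \<phi> \<mu>) = (\<lambda>x. S_op x0 \<psi> x + S_op x0 \<phi> x)"
    by (rule ext, rule S_op_eqI) (simp add: S_op_inner[OF \<psi>] S_op_inner[OF \<phi>] inner_add_left)
qed (rule dirac_diff_in_wass_space)

end
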